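(* Suppose that the penalty constant $c_0>0$ is large enough, i.e. larger than a suitable absolute constant. Then for all $p\in(0,2]$, $\alpha>1/p-1/2$ and $R$ such that $n^{-1/2}\leq R<n^\alpha$, $$\sup_{s\in\mathscr{P}(\alpha,p,R)}\mathbb{E}_s\big[\|s-\tilde{s}\|^2\big]\leq C(c_0,\alpha,p)\,\mathcal{R}(\alpha,p,R),$$ where the constant $C(c_0,\alpha,p)>0$ depends only on $c_0,\alpha,p$.
   Context: Let $r\geq 2$ be an integer and $n=2^N$ a power of $2$. $\mathscr{M}(r,n)$ is the space of real $r\times n$ matrices; for $t\in\mathscr{M}(r,n)$, $t^{(l)}\in\mathbb{R}^n$ is its $l$-th row and $t_i\in\mathbb{R}^r$ its $i$-th column. It carries the inner product $\langle t,t'\rangle=\sum_{i=1}^n\sum_{l=1}^r t_i^{(l)}t_i'^{(l)}$ with norm $\|\cdot\|$; $\langle\cdot,\cdot\rangle_n$ is the standard inner product on $\mathbb{R}^n$ and $\|\cdot\|_r$ the Euclidean norm on $\mathbb{R}^r$. $\mathscr{P}\subset\mathscr{M}(r,n)$ is the set of matrices all of whose columns are probability distributions on $\{1,\ldots,r\}$. Statistical framework. $Y_1,\ldots,Y_n$ are independent random variables with values in $\{1,\ldots,r\}$; their distribution is encoded by $s\in\mathscr{P}$ whose $i$-th column is $s_i=(\mathbb{P}(Y_i=1),\ldots,\mathbb{P}(Y_i=r))^T$. $X$ is the random $r\times n$ matrix with $i$-th column $X_i=(1_{Y_i=1},\ldots,1_{Y_i=r})^T$. $\mathbb{E}_s$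 is expectation when the distribution is $s$. An estimator is a measurable function of $(Y_1,\ldots,Y_n)$ with values in $\mathscr{M}(r,n)$. Dyadic partitions and preliminary estimator. The dyadic intervals of $\{1,\ldots,n\}$ are the sets $\{k2^{N-j}+1,\ldots,(k+1)2^{N-j}\}$, $0\leq j\leq N$, $0\leq k\leq 2^j-1$. $\mathcal{M}$ is the collection of all partitions of $\{1,\ldots,n\}$ into dyadic intervals. For $m\in\mathcal{M}$, $S_m\subset\mathbb{R}^n$ is the linear span of the indicator vectors of the intervals $I\in m$, $D_m=\dim S_m$, and $\mathbb{R}^r\otimes S_m$ is the subspace of matrices whose rows all belong to $S_m$. Let $\hat{s}_m=\operatorname{argmin}_{t\in\mathbb{R}^r\otimes S_m}\|X-t\|^2$, let $\mathrm{pen}(m)=c_0D_m$, let $\hat{m}$ be a minimizer over $m\in\mathcal{M}$ of $\|X-\hat{s}_m\|^2+\mathrm{pen}(m)$, and define the preliminary estimator $\tilde{s}=\hat{s}_{\hat{m}}$. Haar basis and Besov bodies. For $0\leq j\leq N-1$ let $\Lambda(j)=\{(j,k):k=0,\ldots,2^j-1\}$. Let $\varphi:\mathbb{R}\to\{-1,0,1\}$ be equal to $1$ on $(0,1/2]$, $-1$ on $(1/2,1]$ and $0$ elsewhere. For $\lambda=(j,k)\in\Lambda(j)$, $\phi_\lambda\in\mathbb{R}^n$ has $i$-th coordinate $\frac{2^{j/2}}{\sqrt n}\varphi\big(2^j\frac{i}{n}-k\big)$. For $t\in\mathscr{M}(r,n)$ let $\beta_\lambda\in\mathbb{R}^r$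 be the column vector with $l$-th coordinate $\beta_\lambda^{(l)}=\langle t^{(l)},\phi_\lambda\rangle_n$. For $\alpha,p,R>0$, $\mathscr{B}(\alpha,p,R)$ is the set of $t\in\mathscr{M}(r,n)$ such that $$\Big(\sum_{j=0}^{N-1}2^{jp(\alpha+1/2-1/p)}\sum_{\lambda\in\Lambda(j)}\|\beta_\lambda\|_r^p\Big)^{1/p}\leq\sqrt{n}\,R,$$ and $\mathscr{P}(\alpha,p,R)=\mathscr{P}\cap\mathscr{B}(\alpha,p,R)$. The minimax risk is $\mathcal{R}(\alpha,p,R)=\inf_{\hat{s}}\sup_{s\in\mathscr{P}(\alpha,p,R)}\mathbb{E}_s[\|s-\hat{s}\|^2]$, the infimum being over all estimators $\hat{s}$ of $s$. *)

theory Defs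
  imports "HOL-Probability.Probability" "HOL-Library.Function_Algebras"
begin

text \<open>The sizes \<open>r\<close> and \<open>n\<close> vary inside the statement, so vectors of \<open>\<real>\<^sup>n\<close> are
  functions \<open>nat \<Rightarrow> real\<close> supported on \<open>{1..n}\<close> and an \<open>r \<times> n\<close> matrix is a function
  \<open>t :: nat \<Rightarrow> nat \<Rightarrow> real\<close> supported on \<open>{1..r} \<times> {1..n}\<close>: \<open>t l\<close> is the \<open>l\<close>-th row and
  \<open>t l i\<close> is the \<open>l\<close>-th coordinate of the \<open>i\<close>-th column.\<close>

type_synonym rvec = "nat \<Rightarrow> real"
type_synonym rmat = "nat \<Rightarrow> nat \<Rightarrow> real"

definition fscale :: "real \<Rightarrow> rvec \<Rightarrow> rvec" where
  "fscale c v = (\<lambda>i. c * v i)"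

interpretation fvec: vector_space fscale
  by unfold_locales (auto simp: fscale_def fun_eq_iff algebra_simps)

definition Mat :: "nat \<Rightarrow> nat \<Rightarrow> rmat set" where
  "Mat r n = {t. \<forall>l i. t l i \<noteq> 0 \<longrightarrow> l \<in> {1..r} \<and> i \<in> {1..n}}"

definition vec_inner :: "nat \<Rightarrow> rvec \<Rightarrow> rvec \<Rightarrow> real" where
  "vec_inner n u v = (\<Sum>i=1..n. u i * v i)"

definition mat_inner :: "nat \<Rightarrow> nat \<Rightarrow> rmat \<Rightarrow> rmat \<Rightarrow> real" where
  "mat_inner r n t t' = (\<Sum>i=1..n. \<Sum>l=1..r. t l i * t' l i)"

definition mat_norm :: "nat \<Rightarrow> nat \<Rightarrow> rmat \<Rightarrow> real" where
  "mat_norm r n t = sqrt (mat_inner r n t t)"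

definition prob_mats :: "nat \<Rightarrow> nat \<Rightarrow> rmat set" where
  "prob_mats r n =
     {s \<in> Mat r n. \<forall>i\<in>{1..n}. (\<forall>l\<in>{1..r}. 0 \<le> s l i) \<and> (\<Sum>l=1..r. s l i) = 1}"

text \<open>An outcome is \<open>y = (y\<^sub>1, \<dots>, y\<^sub>n)\<close> and the observations are its coordinates. For \<open>s\<close> in
  \<open>prob_mats r n\<close>, \<open>law r n s\<close> is the joint distribution of independent \<open>Y\<^sub>1, \<dots>, Y\<^sub>n\<close> with
  \<open>P(Y\<^sub>i = l) = s l i\<close>.\<close>

definition sample_space :: "nat \<Rightarrow> nat \<Rightarrow> (nat \<Rightarrow> nat) measure" where
  "sample_space r n = PiM {1..n} (\<lambda>_. count_space {1..r})"

definition law :: "nat \<Rightarrow> nat \<Rightarrow> rmat \<Rightarrow> (nat \<Rightarrow> nat) measure" where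
  "law r n s = PiM {1..n} (\<lambda>i. point_measure {1..r} (\<lambda>l. ennreal (s l i)))"

definition obs_mat :: "nat \<Rightarrow> nat \<Rightarrow> (nat \<Rightarrow> nat) \<Rightarrow> rmat" where
  "obs_mat r n y = (\<lambda>l i. if l \<in> {1..r} \<and> i \<in> {1..n} \<and> y i = l then 1 else 0)"

definition estimators :: "nat \<Rightarrow> nat \<Rightarrow> ((nat \<Rightarrow> nat) \<Rightarrow> rmat) set" where
  "estimators r n =
     {e. (\<forall>y \<in> space (sample_space r n). e y \<in> Mat r n) \<and>
         (\<forall>l\<in>{1..r}. \<forall>i\<in>{1..n}. (\<lambda>y. e y l i) \<in> borel_measurable (sample_space r n))}"

definition risk :: "nat \<Rightarrow> nat \<Rightarrow> rmat \<Rightarrow> ((nat \<Rightarrow> nat) \<Rightarrow> rmat) \<Rightarrow> ennreal" where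
  "risk r n s e = (\<integral>\<^sup>+ y. ennreal ((mat_norm r n (s - e y))\<^sup>2) \<partial>law r n s)"

definition dyadic_intervals :: "nat \<Rightarrow> nat set set" where
  "dyadic_intervals N = {{k * 2^(N-j) + 1 .. (k+1) * 2^(N-j)} | j k. j \<le> N \<and> k < 2^j}"

definition dyadic_partitions :: "nat \<Rightarrow> nat set set set" where
  "dyadic_partitions N = {m. m \<subseteq> dyadic_intervals N \<and> partition_on {1..2^N} m}"

definition S_space :: "nat set set \<Rightarrow> rvec set" where
  "S_space m = fvec.span ((\<lambda>I. indicator I) ` m)"

definition D_dim :: "nat set set \<Rightarrow> nat" where
  "D_dim m = fvec.dim (S_space m)"

definition tensor_space :: "nat \<Rightarrow> nat \<Rightarrow> nat set set \<Rightarrow> rmat set" where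
  "tensor_space r n m = {t \<in> Mat r n. \<forall>l\<in>{1..r}. t l \<in> S_space m}"

definition proj_est :: "nat \<Rightarrow> nat \<Rightarrow> nat set set \<Rightarrow> (nat \<Rightarrow> nat) \<Rightarrow> rmat" where
  "proj_est r n m y =
     (ARG_MIN (\<lambda>t. (mat_norm r n (obs_mat r n y - t))\<^sup>2) t. t \<in> tensor_space r n m)"

definition pen :: "real \<Rightarrow> nat set set \<Rightarrow> real" where
  "pen c0 m = c0 * real (D_dim m)"

definition pen_crit :: "real \<Rightarrow> nat \<Rightarrow> nat \<Rightarrow> (nat \<Rightarrow> nat) \<Rightarrow> nat set set \<Rightarrow> real" where
  "pen_crit c0 r n y m = (mat_norm r n (obs_mat r n y - proj_est r n m y))\<^sup>2 + pen c0 m"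

text \<open>The minimizer of the criterion need not be unique: any choice \<open>mhat\<close> is allowed.\<close>

definition is_selector :: "real \<Rightarrow> nat \<Rightarrow> nat \<Rightarrow> ((nat \<Rightarrow> nat) \<Rightarrow> nat set set) \<Rightarrow> bool" where
  "is_selector c0 r N mhat \<longleftrightarrow>
     (\<forall>y \<in> space (sample_space r (2^N)).
        is_arg_min (pen_crit c0 r (2^N) y) (\<lambda>m. m \<in> dyadic_partitions N) (mhat y))"

definition prelim_est ::
  "nat \<Rightarrow> nat \<Rightarrow> ((nat \<Rightarrow> nat) \<Rightarrow> nat set set) \<Rightarrow> (nat \<Rightarrow> nat) \<Rightarrow> rmat" where
  "prelim_est r n mhat y = proj_est r n (mhat y) y"

definition haar_mother :: "real \<Rightarrow> real" where
  "haar_mother x = (if 0 < x \<and> x \<le> 1/2 then 1 else if 1/2 < x \<and> x \<le> 1 then -1 else 0)"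

definition haar :: "nat \<Rightarrow> nat \<Rightarrow> nat \<Rightarrow> rvec" where
  "haar n j k = (\<lambda>i. 2 powr (real j / 2) / sqrt (real n) *
                      haar_mother (2^j * (real i / real n) - real k))"

definition haar_coeff :: "nat \<Rightarrow> rmat \<Rightarrow> nat \<Rightarrow> nat \<Rightarrow> rvec" where
  "haar_coeff n t j k = (\<lambda>l. vec_inner n (t l) (haar n j k))"

definition besov_body :: "nat \<Rightarrow> nat \<Rightarrow> real \<Rightarrow> real \<Rightarrow> real \<Rightarrow> rmat set" where
  "besov_body r N \<alpha> p R =
     {t \<in> Mat r (2^N).
        (\<Sum>j<N. 2 powr (real j * p * (\<alpha> + 1/2 - 1/p)) *
            (\<Sum>k<2^j. L2_set (haar_coeff (2^N) t j k) {1..r} powr p)) powr (1/p)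
        \<le> sqrt (real (2^N)) * R}"

definition besov_probs :: "nat \<Rightarrow> nat \<Rightarrow> real \<Rightarrow> real \<Rightarrow> real \<Rightarrow> rmat set" where
  "besov_probs r N \<alpha> p R = prob_mats r (2^N) \<inter> besov_body r N \<alpha> p R"

definition minimax_risk :: "nat \<Rightarrow> nat \<Rightarrow> real \<Rightarrow> real \<Rightarrow> real \<Rightarrow> ennreal" where
  "minimax_risk r N \<alpha> p R =
     (INF e \<in> estimators r (2^N). SUP s \<in> besov_probs r N \<alpha> p R. risk r (2^N) s e)"

end

theory Submission
  imports Defs
begin

text \<open>
  \<^bold>\<open>Upper bound.\<close> Write \<open>X = s + \<epsilon>\<close>. Comparing the penalized criterion at the selected partition and at
  any other \<open>m\<close> leaves a cross term \<open>\<langle>\<epsilon>, u\<rangle>\<close> with \<open>u\<close> constant on the blocks of a common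
  dyadic refinement, whose cardinality is at most the sum of the two. It is absorbed by
  \<open>T\<^sub>q = \<Sum>\<^sub>I \<parallel>\<Sum>\<^sub>i\<^sub>\<in>\<^sub>I \<epsilon>\<^sub>i\<parallel>\<^sup>2 / |I|\<close>, and \<open>E exp (T\<^sub>q / 16) \<le> exp (|q| / 4)\<close> independently of \<open>r\<close>. As
  \<open>\<Sum>\<^sub>q x\<^bsup>|q|\<^esup> \<le> 1/2\<close> over all dyadic partitions for \<open>x \<le> 1/4\<close>, the supremum of
  \<open>T\<^sub>q - 32 |q|\<close> over \<open>q\<close> has bounded expectation, and a penalty constant above \<open>128\<close> gives an
  oracle inequality. The squared error of a dyadic histogram is the Haar energy outside a tree;
  keeping the coefficients above a level-dependent threshold together with their ancestors yields, on
  a Besov body, error \<open>O(n R\<^sup>2 2\<^bsup>-2J\<alpha>\<^esup>)\<close> with \<open>O(2\<^sup>J)\<close> blocks.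

  \<^bold>\<open>Lower bound.\<close> Perturbing two rows equal to \<open>1/2\<close> by \<open>\<plusminus>\<delta>\<close> times a Haar function on each of the \<open>2\<^sup>J\<close>
  dyadic blocks of level \<open>J\<close>, with \<open>8 \<delta>\<^sup>2\<close> the inverse block length, flipping one sign changes the likelihood by a
  bounded Hellinger distance, so every estimator has risk at least \<open>2\<^sup>J / 32\<close> somewhere
  (Assouad). Both bounds match when \<open>2\<^sup>J\<close> is of order \<open>(n R\<^sup>2)\<^bsup>1/(2\<alpha>+1)\<^esup>\<close>.
\<close>

section \<open>Exponential moments of the noise\<close>

text \<open>A substitute for the exponential series of a centred variable: in expectation the linear
  term drops out and only \<open>exp (x^2)\<close> is left. For x > 1 one has x \<le> x^2, on [0,1]
  the quadratic bound for \<open>exp\<close> suffices, and for x < 0 one inverts exp(-x) \<ge> 1 -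
  x.\<close>

lemma exp_le_add_exp_square: "exp x \<le> x + exp (x\<^sup>2)" for x :: real
proof -
  have sq: "1 + x\<^sup>2 \<le> exp (x\<^sup>2)" by (rule exp_ge_add_one_self)
  consider "x > 1" | "0 \<le> x" "x \<le> 1" | "x < 0" by linarith
  then show ?thesis
  proof cases
    case 1
    then have "x \<le> x\<^sup>2" by (simp add: power2_eq_square)
    then show ?thesis using 1 exp_le_cancel_iff[of x "x\<^sup>2"] by linarith
  next
    case 2
    then show ?thesis using exp_bound[of x] sq by linarith
  next
    case 3
    have "1 - x \<le> exp (- x)" using exp_ge_add_one_self[of "-x"] by simp
    then have "exp x \<le> 1 / (1 - x)"
      using 3 by (simp add: exp_minus field_simps)
    also have "\<dots> \<le> 1 + x + x\<^sup>2"
    proof -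
      have "1 \<le> 1 - x ^ 3" using 3 by (simp add: power3_eq_cube mult_nonpos_nonpos mult_nonneg_nonpos)
      also have "\<dots> = (1 + x + x\<^sup>2) * (1 - x)" by (simp add: power2_eq_square power3_eq_cube algebra_simps)
      finally show ?thesis using 3 by (simp add: field_simps)
    qed
    finally show ?thesis using sq by linarith
  qed
qed

text \<open>Here \<open>v\<close> is the noise already accumulated in a block and
  \<open>of_bool (a = l) - p l\<close> is the increment of one new observation. Expanding the
  square, the increment's own norm costs \<open>exp (2 * u)\<close>, while the cross term is centred
  and bounded by Cauchy-Schwarz, so \<open>exp_le_add_exp_square\<close> leaves only a factor
  \<open>exp (8 * u^2 * V)\<close>.\<close>

lemma categorical_exp_step:
  fixes p v :: "'a \<Rightarrow> real" and u :: real
  assumes fin: "finite A" and p0: "\<And>l. l \<in> A \<Longrightarrow> 0 \<le> p l" and p1: "(\<Sum>l\<in>A. p l) = 1" and u: "0 \<le> u"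
  shows "(\<Sum>a\<in>A. p a * exp (u * (\<Sum>l\<in>A. (v l + (of_bool (a = l) - p l))\<^sup>2)))
    \<le> exp (2 * u) * exp ((u + 8 * u\<^sup>2) * (\<Sum>l\<in>A. (v l)\<^sup>2))"
proof -
  define e where "e a l = (of_bool (a = l) - p l :: real)" for a l
  define V where "V = (\<Sum>l\<in>A. (v l)\<^sup>2)"
  define x where "x a = 2 * u * (\<Sum>l\<in>A. v l * e a l)" for a
  have V0: "V \<ge> 0" unfolding V_def by (intro sum_nonneg) auto
  have pl1: "p l \<le> 1" if "l \<in> A" for l
    using member_le_sum[of l A p] that fin p0 p1 by auto
  \<comment> \<open>The bound 2 is uniform in the number of categories, because each squared entry
    is at most \<open>of_bool (a = l) + p l\<close> and both terms have total mass one.\<close>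
  have e2: "(\<Sum>l\<in>A. (e a l)\<^sup>2) \<le> 2" if a: "a \<in> A" for a
  proof -
    have "(\<Sum>l\<in>A. (e a l)\<^sup>2) \<le> (\<Sum>l\<in>A. of_bool (a = l) + p l)"
    proof (rule sum_mono)
      fix l assume l: "l \<in> A"
      have "(p l)\<^sup>2 \<le> p l" using p0[OF l] pl1[OF l] by (simp add: power2_eq_square mult_left_le)
      then show "(e a l)\<^sup>2 \<le> of_bool (a = l) + p l"
        using p0[OF l] by (auto simp: e_def power2_diff)
    qed
    also have "\<dots> = 2" using fin a p1 by (simp add: sum.distrib of_bool_def)
    finally show ?thesis .
  qed
  have x2: "(x a)\<^sup>2 \<le> 8 * u\<^sup>2 * V" if "a \<in> A" for a
  proof -
    have "(\<Sum>l\<in>A. v l * e a l)\<^sup>2 \<le> V * (\<Sum>l\<in>A. (e a l)\<^sup>2)"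
      unfolding V_def by (rule Cauchy_Schwarz_ineq_sum)
    also have "\<dots> \<le> V * 2" using e2[OF that] V0 by (intro mult_left_mono) auto
    finally have "4 * u\<^sup>2 * (\<Sum>l\<in>A. v l * e a l)\<^sup>2 \<le> 4 * u\<^sup>2 * (V * 2)"
      by (intro mult_left_mono) auto
    then show ?thesis by (simp add: x_def power_mult_distrib)
  qed
  have x0: "(\<Sum>a\<in>A. p a * x a) = 0"
  proof -
    have "(\<Sum>a\<in>A. p a * x a) = 2 * u * (\<Sum>l\<in>A. v l * (\<Sum>a\<in>A. p a * e a l))"
      unfolding x_def sum_distrib_left by (subst sum.swap) (simp add: mult_ac)
    also have "(\<Sum>l\<in>A. v l * (\<Sum>a\<in>A. p a * e a l)) = (\<Sum>l\<in>A. v l * 0)"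
    proof (rule sum.cong[OF refl])
      fix l assume l: "l \<in> A"
      have "(\<Sum>a\<in>A. p a * e a l) = (\<Sum>a\<in>A. p a * of_bool (a = l)) - (\<Sum>a\<in>A. p a) * p l"
        by (simp add: e_def right_diff_distrib sum_subtractf sum_distrib_right)
      also have "\<dots> = 0" using fin l p1 by (simp add: of_bool_def if_distrib cong: if_cong)
      finally show "v l * (\<Sum>a\<in>A. p a * e a l) = v l * 0" by simp
    qed
    finally show ?thesis by simp
  qed
  have "(\<Sum>a\<in>A. p a * exp (u * (\<Sum>l\<in>A. (v l + e a l)\<^sup>2)))
     \<le> (\<Sum>a\<in>A. p a * ((exp (2 * u) * exp (u * V)) * (x a + exp (8 * u\<^sup>2 * V))))"
  proof (intro sum_mono mult_left_mono)
    fix a assume a: "a \<in> A"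
    have "(\<Sum>l\<in>A. (v l + e a l)\<^sup>2) = V + 2 * (\<Sum>l\<in>A. v l * e a l) + (\<Sum>l\<in>A. (e a l)\<^sup>2)"
      by (simp add: V_def power2_sum sum.distrib sum_distrib_left mult_ac)
    also have "\<dots> \<le> V + 2 * (\<Sum>l\<in>A. v l * e a l) + 2" using e2[OF a] by simp
    finally have "u * (\<Sum>l\<in>A. (v l + e a l)\<^sup>2) \<le> u * (V + 2 * (\<Sum>l\<in>A. v l * e a l) + 2)"
      using u by (rule mult_left_mono)
    also have "\<dots> = 2 * u + u * V + x a" by (simp add: x_def algebra_simps)
    finally have "exp (u * (\<Sum>l\<in>A. (v l + e a l)\<^sup>2)) \<le> exp (2 * u) * exp (u * V) * exp (x a)"
      by (simp flip: exp_add)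
    also have "\<dots> \<le> exp (2 * u) * exp (u * V) * (x a + exp (8 * u\<^sup>2 * V))"
    proof (intro mult_left_mono)
      have "exp ((x a)\<^sup>2) \<le> exp (8 * u\<^sup>2 * V)" using x2[OF a] by simp
      then show "exp (x a) \<le> x a + exp (8 * u\<^sup>2 * V)" using exp_le_add_exp_square[of "x a"] by linarith
    qed auto
    finally show "exp (u * (\<Sum>l\<in>A. (v l + e a l)\<^sup>2)) \<le> exp (2 * u) * exp (u * V) * (x a + exp (8 * u\<^sup>2 * V))" .
  qed (use p0 in auto)
  also have "\<dots> = (exp (2 * u) * exp (u * V)) * ((\<Sum>a\<in>A. p a * x a) + (\<Sum>a\<in>A. p a) * exp (8 * u\<^sup>2 * V))"
    by (simp add: sum_distrib_left sum_distrib_right sum.distrib algebra_simps)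
  also have "\<dots> = exp (2 * u) * exp ((u + 8 * u\<^sup>2) * V)"
    by (simp add: x0 p1 algebra_simps flip: exp_add)
  finally show ?thesis by (simp add: e_def V_def)
qed

section \<open>Expectations under finite product laws\<close>

definition prod_expect :: "nat \<Rightarrow> rmat \<Rightarrow> nat set \<Rightarrow> ((nat \<Rightarrow> nat) \<Rightarrow> real) \<Rightarrow> real" where
  "prod_expect r s J f = (\<Sum>y\<in>PiE J (\<lambda>_. {1..r}). (\<Prod>i\<in>J. s (y i) i) * f y)"

text \<open>Fubini for one coordinate. An outcome on \<open>insert i J\<close> is an outcome on
  \<open>J\<close> updated at \<open>i\<close>, which lets coordinates be integrated out one by one
  over growing index sets.\<close>

lemma prod_expect_insert:
  assumes "finite J" "i \<notin> J"
  shows "prod_expect r s (insert i J) f = prod_expect r s J (\<lambda>y. \<Sum>a=1..r. s a i * f (y(i := a)))"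
proof -
  have inj: "inj_on (\<lambda>(a, y). y(i := a)) ({1..r} \<times> PiE J (\<lambda>_. {1..r}))"
    using assms(2) by (rule inj_combinator)
  have "prod_expect r s (insert i J) f
    = (\<Sum>(a,y)\<in>{1..r} \<times> PiE J (\<lambda>_. {1..r}). (\<Prod>i'\<in>insert i J. s ((y(i:=a)) i') i') * f (y(i := a)))"
    unfolding prod_expect_def PiE_insert_eq by (subst sum.reindex[OF inj]) (simp add: case_prod_unfold)
  also have "\<dots> = (\<Sum>(a,y)\<in>{1..r} \<times> PiE J (\<lambda>_. {1..r}). (\<Prod>i'\<in>J. s (y i') i') * (s a i * f (y(i := a))))"
  proof (intro sum.cong refl, clarify)
    fix a y
    have "(\<Prod>i'\<in>J. s ((y(i:=a)) i') i') = (\<Prod>i'\<in>J. s (y i') i')"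
      using assms by (intro prod.cong) auto
    then show "(\<Prod>i'\<in>insert i J. s ((y(i:=a)) i') i') * f (y(i := a)) = (\<Prod>i'\<in>J. s (y i') i') * (s a i * f (y(i := a)))"
      using assms by (simp add: mult_ac)
  qed
  also have "\<dots> = prod_expect r s J (\<lambda>y. \<Sum>a=1..r. s a i * f (y(i := a)))"
    unfolding prod_expect_def sum.cartesian_product[symmetric] sum_distrib_left
    by (rule sum.swap)
  finally show ?thesis .
qed

lemma prod_expect_mono:
  assumes "\<And>i l. i \<in> J \<Longrightarrow> l \<in> {1..r} \<Longrightarrow> 0 \<le> s l i"
    and "\<And>y. y \<in> PiE J (\<lambda>_. {1..r}) \<Longrightarrow> f y \<le> g y"
  shows "prod_expect r s J f \<le> prod_expect r s J g"
  unfolding prod_expect_def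
  using assms by (intro sum_mono mult_left_mono prod_nonneg) (auto simp: PiE_def Pi_def)

lemma prod_expect_cmult: "prod_expect r s J (\<lambda>y. c * f y) = c * prod_expect r s J f"
  by (simp add: prod_expect_def sum_distrib_left mult_ac)

lemma prod_expect_add: "prod_expect r s J (\<lambda>y. f y + g y) = prod_expect r s J f + prod_expect r s J g"
  by (simp add: prod_expect_def distrib_left sum.distrib)

lemma prod_expect_sum: "prod_expect r s J (\<lambda>y. \<Sum>m\<in>M. f m y) = (\<Sum>m\<in>M. prod_expect r s J (f m))"
  unfolding prod_expect_def sum_distrib_left by (rule sum.swap)

lemma prod_expect_const:
  assumes "finite J" "\<And>i. i \<in> J \<Longrightarrow> (\<Sum>l=1..r. s l i) = 1"
  shows "prod_expect r s J (\<lambda>_. c) = c"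
  using assms
proof (induction J)
  case empty
  then show ?case by (simp add: prod_expect_def)
next
  case (insert i J)
  then show ?case by (simp add: prod_expect_insert flip: sum_distrib_right)
qed

text \<open>Coordinates are integrated out one at a time. By the one-step bound, revealing the
  \<open>(k+1)\<close>-st coordinate of a block turns the weight \<open>u\<close> into at most \<open>u + 8 u\<^sup>2\<close>; the weights
  \<open>1 / (8 (|I| + k))\<close> are chosen to be stable under this recursion.\<close>

lemma exp_moment_partial_blocks:
  assumes s0: "\<And>i l. i \<in> U \<Longrightarrow> l \<in> {1..r} \<Longrightarrow> 0 \<le> s l i"
    and s1: "\<And>i. i \<in> U \<Longrightarrow> (\<Sum>l=1..r. s l i) = 1"
    and U: "finite U" and m: "partition_on U m" and J: "J \<subseteq> U"
  shows "prod_expect r s J (\<lambda>y. exp (\<Sum>I\<in>m. 1 / (8 * (real (card I) + real (card (I \<inter> J)))) *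
       (\<Sum>l=1..r. (\<Sum>i\<in>I \<inter> J. of_bool (y i = l) - s l i)\<^sup>2)))
     \<le> exp (\<Sum>I\<in>m. real (card (I \<inter> J)) / (4 * real (card I)))"
  using finite_subset[OF J U] J
proof (induction J)
  case empty
  then show ?case by (simp add: prod_expect_def)
next
  case (insert i J)
  have iU: "i \<in> U" and JU: "J \<subseteq> U" using insert.prems by auto
  have finm: "finite m" using U m by (rule finite_elements)
  obtain K where K: "K \<in> m" "i \<in> K" using m iU by (auto simp: partition_on_def)
  have iI: "i \<notin> I" if "I \<in> m - {K}" for I
    using partition_onD2[OF m] K that by (auto simp: disjoint_def)
  have finI: "finite I" if "I \<in> m" for I
    using m U that by (auto simp: partition_on_def intro: finite_subset)
  define c where "c = card K"
  define k where "k = card (K \<inter> J)"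
  have c0: "c > 0" using K finI[OF K(1)] by (auto simp: c_def card_gt_0_iff)
  have KJ: "K \<inter> insert i J = insert i (K \<inter> J)" using K by auto
  have ck: "card (K \<inter> insert i J) = Suc k"
    unfolding KJ k_def using finI[OF K(1)] insert.hyps by simp
  define u where "u = 1 / (8 * (real c + real (Suc k)))"
  define u' where "u' = 1 / (8 * (real c + real k))"
  have u0: "u \<ge> 0" by (simp add: u_def)
  \<comment> \<open>With z = |K| + k the left side equals (z + 2) / (8 (z + 1)^2), so the claim is z
    (z + 2) \<le> (z + 1)^2.\<close>
  have uu: "u + 8 * u\<^sup>2 \<le> u'"
  proof -
    define z where "z = real c + real k"
    have z: "z > 0" using c0 by (simp add: z_def)
    have u: "u = 1 / (8 * (z + 1))" "u' = 1 / (8 * z)" by (simp_all add: u_def u'_def z_def add_ac)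
    have "u + 8 * u\<^sup>2 = (z + 2) / (8 * (z + 1)\<^sup>2)"
      unfolding u using z by (simp add: divide_simps) (simp add: power2_eq_square algebra_simps)
    also have "\<dots> \<le> u'"
      unfolding u using z by (simp add: divide_simps) (simp add: power2_eq_square algebra_simps)
    finally show ?thesis .
  qed
  \<comment> \<open>Each integrated coordinate costs 1 / (4 |K|), hence a fully revealed block costs
    1/4 in total.\<close>
  have ub: "2 * u \<le> 1 / (4 * real c)" unfolding u_def using c0 by (simp add: field_simps)
  define w where "w J y I = 1 / (8 * (real (card I) + real (card (I \<inter> J)))) *
       (\<Sum>l=1..r. (\<Sum>i\<in>I \<inter> J. of_bool (y i = l) - s l i)\<^sup>2)" for J y I
  have same: "w (insert i J) (y(i := a)) I = w J y I" if "I \<in> m - {K}" for y a I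
  proof -
    have "I \<inter> insert i J = I \<inter> J" using iI[OF that] by auto
    moreover have "(\<Sum>i'\<in>I \<inter> J. of_bool ((y(i := a)) i' = l) - s l i') = (\<Sum>i'\<in>I \<inter> J. of_bool (y i' = l) - s l i')" for l
      using insert.hyps by (intro sum.cong) auto
    ultimately show ?thesis by (simp only: w_def)
  qed
  have "prod_expect r s (insert i J) (\<lambda>y. exp (\<Sum>I\<in>m. w (insert i J) y I))
      = prod_expect r s J (\<lambda>y. \<Sum>a=1..r. s a i * exp (\<Sum>I\<in>m. w (insert i J) (y(i := a)) I))"
    using insert.hyps by (rule prod_expect_insert)
  also have "\<dots> \<le> prod_expect r s J (\<lambda>y. exp (1 / (4 * real c)) * exp (\<Sum>I\<in>m. w J y I))"
  proof (rule prod_expect_mono)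
    fix y
    define v where "v l = (\<Sum>i\<in>K \<inter> J. of_bool (y i = l) - s l i)" for l
    have wK: "w (insert i J) (y(i := a)) K = u * (\<Sum>l=1..r. (v l + (of_bool (a = l) - s l i))\<^sup>2)" for a
    proof -
      have "(\<Sum>i'\<in>K \<inter> insert i J. of_bool ((y(i := a)) i' = l) - s l i') = v l + (of_bool (a = l) - s l i)" for l
      proof -
        have "(\<Sum>i'\<in>K \<inter> J. of_bool ((y(i := a)) i' = l) - s l i') = v l"
          unfolding v_def using insert.hyps by (intro sum.cong) auto
        then show ?thesis unfolding KJ using finI[OF K(1)] insert.hyps by simp
      qed
      then show ?thesis by (simp only: w_def ck u_def c_def)
    qed
    have wK': "w J y K = u' * (\<Sum>l=1..r. (v l)\<^sup>2)" by (simp add: w_def u'_def v_def c_def k_def)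
    define B where "B = (\<Sum>I\<in>m - {K}. w J y I)"
    have split: "(\<Sum>I\<in>m. w (insert i J) (y(i := a)) I) = w (insert i J) (y(i := a)) K + B" for a
      unfolding B_def using same by (subst sum.remove[OF finm K(1)]) simp
    have split': "(\<Sum>I\<in>m. w J y I) = w J y K + B"
      unfolding B_def by (rule sum.remove[OF finm K(1)])
    have "(\<Sum>a=1..r. s a i * exp (\<Sum>I\<in>m. w (insert i J) (y(i := a)) I))
      = exp B * (\<Sum>a=1..r. s a i * exp (u * (\<Sum>l=1..r. (v l + (of_bool (a = l) - s l i))\<^sup>2)))"
      by (simp add: split wK exp_add sum_distrib_left mult_ac)
    also have "\<dots> \<le> exp B * (exp (2 * u) * exp ((u + 8 * u\<^sup>2) * (\<Sum>l=1..r. (v l)\<^sup>2)))"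
      using categorical_exp_step[of "{1..r}" "\<lambda>l. s l i" u v] s0[OF iU] s1[OF iU] u0
      by (intro mult_left_mono) auto
    also have "\<dots> \<le> exp B * (exp (1 / (4 * real c)) * exp (u' * (\<Sum>l=1..r. (v l)\<^sup>2)))"
      using uu ub by (intro mult_left_mono mult_mono) (auto intro!: mult_right_mono sum_nonneg)
    also have "\<dots> = exp (1 / (4 * real c)) * exp (\<Sum>I\<in>m. w J y I)"
      by (simp add: split' wK' exp_add mult_ac)
    finally show "(\<Sum>a=1..r. s a i * exp (\<Sum>I\<in>m. w (insert i J) (y(i := a)) I)) \<le> \<dots>" .
  qed (use JU s0 in auto)
  also have "\<dots> \<le> exp (1 / (4 * real c)) * exp (\<Sum>I\<in>m. real (card (I \<inter> J)) / (4 * real (card I)))"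
    unfolding prod_expect_cmult w_def using insert.IH[OF JU] by (intro mult_left_mono) auto
  also have "\<dots> = exp (\<Sum>I\<in>m. real (card (I \<inter> insert i J)) / (4 * real (card I)))"
  proof -
    have "(\<Sum>I\<in>m - {K}. real (card (I \<inter> insert i J)) / (4 * real (card I)))
        = (\<Sum>I\<in>m - {K}. real (card (I \<inter> J)) / (4 * real (card I)))"
      using iI by (intro sum.cong) (auto simp: Int_insert_right)
    then have "(\<Sum>I\<in>m. real (card (I \<inter> insert i J)) / (4 * real (card I)))
       = 1 / (4 * real c) + (\<Sum>I\<in>m. real (card (I \<inter> J)) / (4 * real (card I)))"
      by (simp add: sum.remove[OF finm K(1)] ck add_divide_distrib flip: c_def k_def)
    then show ?thesis by (simp add: exp_add)
  qed
  finally show ?case unfolding w_def .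
qed

text \<open>The squared norm of the orthogonal projection of the noise X - s onto the matrices that
  are constant on the blocks of \<open>m\<close>.\<close>

definition noise_stat :: "nat \<Rightarrow> rmat \<Rightarrow> nat set set \<Rightarrow> (nat \<Rightarrow> nat) \<Rightarrow> real" where
  "noise_stat r s m y =
     (\<Sum>I\<in>m. (\<Sum>l=1..r. (\<Sum>i\<in>I. of_bool (y i = l) - s l i)\<^sup>2) / real (card I))"

text \<open>The case \<open>J = U\<close> of the previous bound: every weight becomes 1 / (16 |I|)
  and every block contributes exactly 1/4 to the exponent.\<close>

lemma exp_moment_noise_stat:
  assumes "\<And>i l. i \<in> U \<Longrightarrow> l \<in> {1..r} \<Longrightarrow> 0 \<le> s l i"
    and "\<And>i. i \<in> U \<Longrightarrow> (\<Sum>l=1..r. s l i) = 1"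
    and U: "finite U" and m: "partition_on U m"
  shows "prod_expect r s U (\<lambda>y. exp (noise_stat r s m y / 16)) \<le> exp (real (card m) / 4)"
proof -
  have sub: "I \<inter> U = I" and c0: "card I > 0" if "I \<in> m" for I
    using m that U by (auto simp: partition_on_def card_gt_0_iff intro: finite_subset)
  have 1: "(\<Sum>I\<in>m. 1 / (8 * (real (card I) + real (card (I \<inter> U)))) *
       (\<Sum>l=1..r. (\<Sum>i\<in>I \<inter> U. of_bool (y i = l) - s l i)\<^sup>2)) = noise_stat r s m y / 16" for y
    unfolding noise_stat_def sum_divide_distrib[where A = m] by (intro sum.cong) (auto simp: sub)
  have 2: "(\<Sum>I\<in>m. real (card (I \<inter> U)) / (4 * real (card I))) = real (card m) / 4"
  proof -
    have "(\<Sum>I\<in>m. real (card (I \<inter> U)) / (4 * real (card I))) = (\<Sum>I\<in>m. 1 / 4)"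
      using c0 by (intro sum.cong) (auto simp: sub)
    then show ?thesis by simp
  qed
  show ?thesis using exp_moment_partial_blocks[of U r s m U, OF assms order_refl] unfolding 1 2 by blast
qed

text \<open>Replaces the product measure by explicit weights on a finite set, so that all later
  expectations are finite sums. The two measures are compared on singletons, which are boxes of
  singletons.\<close>

lemma law_eq_point_measure:
  "law r n s = point_measure (PiE {1..n} (\<lambda>_. {1..r})) (\<lambda>y. \<Prod>i=1..n. ennreal (s (y i) i))"
proof -
  interpret product_sigma_finite "\<lambda>i. point_measure {1..r} (\<lambda>l. ennreal (s l i))"
  proof
    fix i
    have "finite_measure (point_measure {1..r} (\<lambda>l. ennreal (s l i)))"
      by (rule finite_measureI) (simp add: space_point_measure emeasure_point_measure_finite)
    then interpret finite_measure "point_measure {1..r} (\<lambda>l. ennreal (s l i))" .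
    show "\<exists>A::nat set set. countable A \<and> A \<subseteq> sets (point_measure {1..r} (\<lambda>l. ennreal (s l i))) \<and>
      \<Union> A = space (point_measure {1..r} (\<lambda>l. ennreal (s l i))) \<and>
      (\<forall>a\<in>A. emeasure (point_measure {1..r} (\<lambda>l. ennreal (s l i))) a \<noteq> \<infinity>)"
      by (rule sigma_finite_countable)
  qed
  have PiE: "PiE {1..n} (\<lambda>i. {y i}) = {y}" if "y \<in> PiE {1..n} (\<lambda>_. {1..r})" for y :: "nat \<Rightarrow> nat"
    using that by (intro PiE_singleton) (auto simp: PiE_def)
  have fin: "finite (PiE {1..n} (\<lambda>_. {1..r}))" by (intro finite_PiE) auto
  show ?thesis unfolding law_def
  proof (rule measure_eqI_countable')
    fix y assume y: "y \<in> PiE {1..n} (\<lambda>_. {1..r})"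
    have mem: "y i \<in> {1..r}" if "i \<in> {1..n}" for i using PiE_mem[OF y that] .
    have "PiE {1..n} (\<lambda>i. {y i}) \<in> sets (\<Pi>\<^sub>M i\<in>{1..n}. point_measure {1..r} (\<lambda>l. ennreal (s l i)))"
      using mem by (intro sets_PiM_I_finite) (auto simp: sets_point_measure)
    then show "{y} \<in> sets (\<Pi>\<^sub>M i\<in>{1..n}. point_measure {1..r} (\<lambda>l. ennreal (s l i)))"
      by (simp only: PiE[OF y])
    have "emeasure (\<Pi>\<^sub>M i\<in>{1..n}. point_measure {1..r} (\<lambda>l. ennreal (s l i))) (PiE {1..n} (\<lambda>i. {y i}))
        = (\<Prod>i=1..n. emeasure (point_measure {1..r} (\<lambda>l. ennreal (s l i))) {y i})"
      using mem by (intro emeasure_PiM) (auto simp: sets_point_measure)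
    also have "\<dots> = (\<Prod>i=1..n. ennreal (s (y i) i))"
      using mem by (intro prod.cong refl) (subst emeasure_point_measure_finite, auto)
    finally have "emeasure (\<Pi>\<^sub>M i\<in>{1..n}. point_measure {1..r} (\<lambda>l. ennreal (s l i))) {y} = (\<Prod>i=1..n. ennreal (s (y i) i))"
      by (simp only: PiE[OF y])
    then show "emeasure (\<Pi>\<^sub>M i\<in>{1..n}. point_measure {1..r} (\<lambda>l. ennreal (s l i))) {y}
       = emeasure (point_measure (PiE {1..n} (\<lambda>_. {1..r})) (\<lambda>y. \<Prod>i=1..n. ennreal (s (y i) i))) {y}"
      using y fin by (simp add: emeasure_point_measure_finite)
  qed (use fin in \<open>auto simp: space_PiM space_point_measure sets_point_measure intro: countable_finite\<close>)
qed

lemma mat_norm_square: "(mat_norm r n t)\<^sup>2 = (\<Sum>i=1..n. \<Sum>l=1..r. (t l i)\<^sup>2)"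
  by (simp add: mat_norm_def mat_inner_def power2_eq_square sum_nonneg)

lemma risk_eq_prod_expect:
  assumes "s \<in> prob_mats r n"
  shows "risk r n s e = ennreal (prod_expect r s {1..n} (\<lambda>y. (mat_norm r n (s - e y))\<^sup>2))"
proof -
  have s0: "0 \<le> s (y i) i" if "y \<in> PiE {1..n} (\<lambda>_. {1..r})" "i \<in> {1..n}" for y i
    using assms PiE_mem[OF that] that(2) by (auto simp: prob_mats_def)
  have fin: "finite (PiE {1..n} (\<lambda>_. {1..r}))" by (intro finite_PiE) auto
  have "risk r n s e = (\<Sum>y\<in>PiE {1..n} (\<lambda>_. {1..r}).
      (\<Prod>i=1..n. ennreal (s (y i) i)) * ennreal ((mat_norm r n (s - e y))\<^sup>2))"
    unfolding risk_def law_eq_point_measure by (rule nn_integral_point_measure_finite[OF fin])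
  also have "\<dots> = (\<Sum>y\<in>PiE {1..n} (\<lambda>_. {1..r}). ennreal ((\<Prod>i=1..n. s (y i) i) * (mat_norm r n (s - e y))\<^sup>2))"
    using s0 by (intro sum.cong refl) (subst prod_ennreal, auto intro!: ennreal_mult[symmetric] prod_nonneg)
  also have "\<dots> = ennreal (prod_expect r s {1..n} (\<lambda>y. (mat_norm r n (s - e y))\<^sup>2))"
    unfolding prod_expect_def using s0 by (intro sum_ennreal) (auto intro!: mult_nonneg_nonneg prod_nonneg)
  finally show ?thesis .
qed

section \<open>Dyadic partitions\<close>

definition dyad :: "nat \<Rightarrow> nat \<Rightarrow> nat \<Rightarrow> nat set" where
  "dyad N j k = {k * 2^(N-j) + 1 .. (k+1) * 2^(N-j)}"

text \<open>The block index is the quotient of the zero-based position \<open>i - 1\<close> by the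
  block length. Nesting and splitting of dyadic intervals thereby become facts about iterated
  division.\<close>

lemma mem_dyad: "i \<in> dyad N j k \<longleftrightarrow> 1 \<le> i \<and> (i - 1) div 2^(N-j) = k"
proof (cases i)
  case (Suc i')
  have "i' div 2^(N-j) = k \<longleftrightarrow> k * 2^(N-j) \<le> i' \<and> i' < (k+1) * 2^(N-j)"
  proof
    assume "i' div 2^(N-j) = k"
    then show "k * 2^(N-j) \<le> i' \<and> i' < (k+1) * 2^(N-j)"
      using div_times_less_eq_dividend[of i' "2^(N-j)"] dividend_less_div_times[of "2^(N-j)" i'] by auto
  next
    assume "k * 2^(N-j) \<le> i' \<and> i' < (k+1) * 2^(N-j)"
    then show "i' div 2^(N-j) = k"
      by (intro div_nat_eqI) (auto simp: mult.commute)
  qed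
  then show ?thesis using Suc by (auto simp: dyad_def)
qed (simp add: dyad_def)

lemma dyadic_intervals_eq: "dyadic_intervals N = {dyad N j k | j k. j \<le> N \<and> k < 2^j}"
  by (simp add: dyadic_intervals_def dyad_def)

lemma dyad_in_dyadic_intervals: "j \<le> N \<Longrightarrow> k < 2^j \<Longrightarrow> dyad N j k \<in> dyadic_intervals N"
  unfolding dyadic_intervals_eq by blast

lemma finite_dyadic_intervals: "finite (dyadic_intervals N)"
proof -
  have "dyadic_intervals N = (\<lambda>(j,k). dyad N j k) ` (SIGMA j:{..N}. {..<2^j})"
    unfolding dyadic_intervals_eq by auto
  then show ?thesis by simp
qed

lemma card_dyad: "card (dyad N j k) = 2^(N-j)"
  by (simp add: dyad_def)

lemma finite_dyad: "finite (dyad N j k)"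
  by (simp add: dyad_def)

lemma dyad_nonempty: "dyad N j k \<noteq> {}"
  using card_dyad[of N j k] by (metis card.empty power_not_zero zero_neq_numeral)

lemma dyad_root: "dyad N 0 0 = {1..2^N}"
  by (simp add: dyad_def)

lemma dyad_leaf: "dyad N N k = {k + 1}"
  by (simp add: dyad_def)

text \<open>Dividing \<open>i - 1\<close> by the longer block length can be done in two stages:
  first by the shorter length, then by \<open>2^(j-j')\<close>.\<close>

lemma dyad_subset_ancestor:
  assumes "j' \<le> j" "j \<le> N"
  shows "dyad N j k \<subseteq> dyad N j' (k div 2^(j-j'))"
proof
  fix i assume i: "i \<in> dyad N j k"
  have "(2::nat)^(N-j') = 2^(N-j) * 2^(j-j')" using assms by (simp flip: power_add)
  then show "i \<in> dyad N j' (k div 2^(j-j'))"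
    using i by (auto simp: mem_dyad div_mult2_eq)
qed

lemma dyad_nested:
  assumes "j' \<le> j" "j \<le> N"
  shows "dyad N j k \<subseteq> dyad N j' k' \<or> dyad N j k \<inter> dyad N j' k' = {}"
proof (cases "k' = k div 2^(j-j')")
  case True
  then show ?thesis using dyad_subset_ancestor[OF assms] by simp
next
  case False
  then have "i \<notin> dyad N j' k'" if "i \<in> dyad N j k" for i
    using subsetD[OF dyad_subset_ancestor[OF assms] that] by (auto simp: mem_dyad)
  then show ?thesis by auto
qed

lemma dyadic_intervals_nested:
  assumes "I \<in> dyadic_intervals N" "J \<in> dyadic_intervals N"
  shows "I \<subseteq> J \<or> J \<subseteq> I \<or> I \<inter> J = {}"
proof -
  obtain j k j' k' where "I = dyad N j k" "j \<le> N" "J = dyad N j' k'" "j' \<le> N"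
    using assms unfolding dyadic_intervals_eq by blast
  then show ?thesis using dyad_nested[of j' j N k k'] dyad_nested[of j j' N k' k]
    by (cases "j \<le> j'") auto
qed

lemma dyad_split:
  assumes "j < N"
  shows "dyad N j k = dyad N (Suc j) (2*k) \<union> dyad N (Suc j) (2*k+1)"
    and "dyad N (Suc j) (2*k) \<inter> dyad N (Suc j) (2*k+1) = {}"
proof -
  have e: "(2::nat)^(N-j) = 2^(N-Suc j) * 2" using assms by (simp flip: power_Suc2 add: Suc_diff_Suc)
  show "dyad N j k = dyad N (Suc j) (2*k) \<union> dyad N (Suc j) (2*k+1)"
  proof (rule set_eqI)
    fix i
    have "(x::nat) div 2 = k \<longleftrightarrow> x = 2*k \<or> x = 2*k+1" for x by auto
    then show "i \<in> dyad N j k \<longleftrightarrow> i \<in> dyad N (Suc j) (2*k) \<union> dyad N (Suc j) (2*k+1)"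
      unfolding Un_iff mem_dyad e div_mult2_eq by blast
  qed
  show "dyad N (Suc j) (2*k) \<inter> dyad N (Suc j) (2*k+1) = {}"
    by (auto simp: mem_dyad)
qed

text \<open>Dyadic partitions of an arbitrary node rather than of the whole range, so that
  statements can be proved by induction on the height \<open>N - j\<close>.\<close>

definition dyadic_parts :: "nat \<Rightarrow> nat \<Rightarrow> nat \<Rightarrow> nat set set set" where
  "dyadic_parts N j k = {m. m \<subseteq> dyadic_intervals N \<and> partition_on (dyad N j k) m}"

lemma dyadic_partitions_eq: "dyadic_partitions N = dyadic_parts N 0 0"
  by (simp add: dyadic_partitions_def dyadic_parts_def dyad_root)

lemma finite_dyadic_parts: "finite (dyadic_parts N j k)"
  by (rule finite_subset[OF _ finite_Pow_iff[THEN iffD2, OF finite_dyadic_intervals]])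
     (auto simp: dyadic_parts_def)

lemma partition_on_Un:
  assumes "partition_on A P" "partition_on B Q" "A \<inter> B = {}"
  shows "partition_on (A \<union> B) (P \<union> Q)" and "P \<inter> Q = {}"
proof -
  have PQ: "p \<inter> q = {}" if "p \<in> P" "q \<in> Q" for p q
    using that assms by (auto simp: partition_on_def)
  have "disjoint (P \<union> Q)"
    using partition_onD2[OF assms(1)] partition_onD2[OF assms(2)] PQ unfolding disjoint_def by (metis Int_commute Un_iff)
  then show "partition_on (A \<union> B) (P \<union> Q)"
    using assms by (auto simp: partition_on_def)
  show "P \<inter> Q = {}"
    using PQ assms(1) by (metis Int_absorb disjoint_iff partition_onD3)
qed

lemma partition_on_restrict_subset:
  assumes "partition_on C m" "\<And>x. x \<in> A \<Longrightarrow> \<exists>I\<in>m. I \<subseteq> A \<and> x \<in> I"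
  shows "partition_on A {I \<in> m. I \<subseteq> A}"
proof -
  have "\<Union>{I \<in> m. I \<subseteq> A} = A" using assms(2) by fast
  moreover have "disjoint {I \<in> m. I \<subseteq> A}"
    using partition_onD2[OF assms(1)] by (simp add: disjoint_def)
  ultimately show ?thesis using partition_onD3[OF assms(1)] by (simp add: partition_on_def)
qed

lemma partition_on_block:
  assumes "finite U" "partition_on U m" "I \<in> m"
  shows "finite I" "I \<noteq> {}" "I \<subseteq> U"
proof -
  show "I \<subseteq> U" using partition_onD1[OF assms(2)] assms(3) by blast
  then show "finite I" using assms(1) by (rule finite_subset)
  show "I \<noteq> {}" using partition_onD3[OF assms(2)] assms(3) by blast
qed

lemma dyadic_parts_Un:
  assumes "j < N" "m1 \<in> dyadic_parts N (Suc j) (2*k)" "m2 \<in> dyadic_parts N (Suc j) (2*k+1)"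
  shows "m1 \<union> m2 \<in> dyadic_parts N j k" and "m1 \<inter> m2 = {}"
proof -
  have p: "partition_on (dyad N (Suc j) (2*k)) m1" "partition_on (dyad N (Suc j) (2*k+1)) m2"
    using assms by (auto simp: dyadic_parts_def)
  note pu = partition_on_Un[OF p dyad_split(2)[OF assms(1)]]
  show "m1 \<union> m2 \<in> dyadic_parts N j k"
    using assms pu(1) unfolding dyadic_parts_def dyad_split(1)[OF assms(1), of k] by auto
  show "m1 \<inter> m2 = {}" by (rule pu(2))
qed

text \<open>A partition other than the single block cannot contain a block crossing the midpoint,
  since dyadic intervals are nested or disjoint. The blocks therefore sort into the left and the
  right half.\<close>

lemma dyadic_parts_split:
  assumes "j < N" "k < 2^j" "m \<in> dyadic_parts N j k" "m \<noteq> {dyad N j k}"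
  obtains m1 m2 where "m = m1 \<union> m2"
    "m1 \<in> dyadic_parts N (Suc j) (2*k)" "m2 \<in> dyadic_parts N (Suc j) (2*k+1)"
proof -
  define A where "A = dyad N (Suc j) (2*k)"
  define B where "B = dyad N (Suc j) (2*k+1)"
  have AB: "dyad N j k = A \<union> B" "A \<inter> B = {}"
    using dyad_split[OF assms(1), of k] by (auto simp: A_def B_def)
  have m: "m \<subseteq> dyadic_intervals N" "partition_on (dyad N j k) m" using assms by (auto simp: dyadic_parts_def)
  have whole: "dyad N j k \<notin> m"
  proof
    assume w: "dyad N j k \<in> m"
    have "I = dyad N j k" if "I \<in> m" for I
    proof (rule ccontr)
      assume "I \<noteq> dyad N j k"
      then have "I \<inter> dyad N j k = {}" using partition_onD2[OF m(2)] w that by (auto simp: disjoint_def)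
      moreover have "I \<subseteq> dyad N j k" "I \<noteq> {}" using m(2) that by (auto simp: partition_on_def)
      ultimately show False by auto
    qed
    then show False using w assms(4) by blast
  qed
  have half: "I \<subseteq> A \<or> I \<subseteq> B" if I: "I \<in> m" for I
  proof -
    obtain j' k' where I': "I = dyad N j' k'" "j' \<le> N" "k' < 2^j'"
      using m(1) I unfolding dyadic_intervals_eq by blast
    have sub: "I \<subseteq> A \<union> B" "I \<noteq> {}" using m(2) I by (auto simp: partition_on_def AB)
    \<comment> \<open>A block of level at most \<open>j\<close> meeting the node would contain it,
      hence be equal to it, which \<open>whole\<close> excludes.\<close>
    have "Suc j \<le> j'"
    proof (rule ccontr)
      assume "\<not> Suc j \<le> j'"
      then have "dyad N j k \<subseteq> I" using dyad_nested[of j' j N k k'] assms(1) sub I' AB by auto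
      then have "I = dyad N j k" using sub AB by auto
      then show False using whole I by simp
    qed
    then show ?thesis
      using dyad_nested[of "Suc j" j' N k' "2*k"] I' sub unfolding A_def B_def by auto
  qed
  have P: "partition_on A {I \<in> m. I \<subseteq> A}" "partition_on B {I \<in> m. I \<subseteq> B}"
  proof -
    have UN: "\<Union>m = A \<union> B" using m(2) AB by (auto simp: partition_on_def)
    have "\<exists>I\<in>m. I \<subseteq> A \<and> x \<in> I" if "x \<in> A" for x
    proof -
      have "x \<in> \<Union>m" using UN that by simp
      then obtain I where "I \<in> m" "x \<in> I" by (rule UnionE)
      then show ?thesis using half AB(2) that by blast
    qed
    moreover have "\<exists>I\<in>m. I \<subseteq> B \<and> x \<in> I" if "x \<in> B" for x
    proof -
      have "x \<in> \<Union>m" using UN that by simp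
      then obtain I where "I \<in> m" "x \<in> I" by (rule UnionE)
      then show ?thesis using half AB(2) that by blast
    qed
    ultimately show "partition_on A {I \<in> m. I \<subseteq> A}" "partition_on B {I \<in> m. I \<subseteq> B}"
      by (auto intro: partition_on_restrict_subset[OF m(2)])
  qed
  show ?thesis
  proof (rule that)
    show "m = {I \<in> m. I \<subseteq> A} \<union> {I \<in> m. I \<subseteq> B}" using half by auto
    show "{I \<in> m. I \<subseteq> A} \<in> dyadic_parts N (Suc j) (2*k)"
      "{I \<in> m. I \<subseteq> B} \<in> dyadic_parts N (Suc j) (2*k+1)"
      using P m(1) by (auto simp: dyadic_parts_def A_def B_def)
  qed
qed

text \<open>A node is either one block or a pair of partitions of its children, so the generating
  function f satisfies f(j) \<le> x + f(j+1)^2. The bound 1/2 reproduces itself because 1/4 +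
  (1/2)^2 = 1/2.\<close>

lemma sum_power_card_dyadic_parts:
  fixes x :: real
  assumes "0 \<le> x" "x \<le> 1/4" "j \<le> N" "k < 2^j"
  shows "(\<Sum>m\<in>dyadic_parts N j k. x ^ card m) \<le> 1/2"
  using assms(3,4)
proof (induction "N - j" arbitrary: j k)
  case 0
  then have j: "j = N" by simp
  have "m = {{k+1}}" if "m \<in> dyadic_parts N j k" for m
  proof -
    have m: "\<Union>m = {k+1}" "{} \<notin> m" using that by (auto simp: dyadic_parts_def partition_on_def dyad_leaf j)
    then have "I = {k+1}" if "I \<in> m" for I using that by (metis Union_upper subset_singletonD)
    then show ?thesis using m by auto
  qed
  then have "dyadic_parts N j k \<subseteq> {{{k+1}}}" by auto
  then have "(\<Sum>m\<in>dyadic_parts N j k. x ^ card m) \<le> (\<Sum>m\<in>{{{k+1}}}. x ^ card m)"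
    using assms by (intro sum_mono2) auto
  then show ?case using assms by simp
next
  case (Suc d)
  then have j: "j < N" by simp
  define P1 where "P1 = dyadic_parts N (Suc j) (2*k)"
  define P2 where "P2 = dyadic_parts N (Suc j) (2*k+1)"
  have fin: "finite P1" "finite P2" by (auto simp: P1_def P2_def finite_dyadic_parts)
  have finm: "finite m" if "m \<in> dyadic_parts N j k" for m j k
    using that finite_elements[OF finite_dyad] by (auto simp: dyadic_parts_def)
  have "dyadic_parts N j k \<subseteq> insert {dyad N j k} ((\<lambda>(a,b). a \<union> b) ` (P1 \<times> P2))"
  proof
    fix m assume m: "m \<in> dyadic_parts N j k"
    show "m \<in> insert {dyad N j k} ((\<lambda>(a,b). a \<union> b) ` (P1 \<times> P2))"
    proof (cases "m = {dyad N j k}")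
      case False
      from dyadic_parts_split[OF j Suc.prems(2) m False] show ?thesis
        unfolding P1_def P2_def by (metis (no_types, lifting) SigmaI image_eqI insertCI prod.simps(2))
    qed simp
  qed
  then have "(\<Sum>m\<in>dyadic_parts N j k. x ^ card m)
      \<le> (\<Sum>m\<in>insert {dyad N j k} ((\<lambda>(a,b). a \<union> b) ` (P1 \<times> P2)). x ^ card m)"
    using fin assms by (intro sum_mono2) auto
  also have "\<dots> \<le> x ^ card {dyad N j k} + (\<Sum>m\<in>(\<lambda>(a,b). a \<union> b) ` (P1 \<times> P2). x ^ card m)"
    using fin assms by (subst sum.insert_if) auto
  also have "(\<Sum>m\<in>(\<lambda>(a,b). a \<union> b) ` (P1 \<times> P2). x ^ card m) \<le> (\<Sum>(a,b)\<in>P1 \<times> P2. x ^ card (a \<union> b))"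
    using sum_image_le[of "P1 \<times> P2" "\<lambda>m. x ^ card m" "\<lambda>(a,b). a \<union> b"] fin assms
    by (simp add: case_prod_unfold comp_def)
  also have "(\<Sum>(a,b)\<in>P1 \<times> P2. x ^ card (a \<union> b)) = (\<Sum>(a,b)\<in>P1 \<times> P2. x ^ card a * x ^ card b)"
  proof (intro sum.cong refl, clarify)
    fix a b assume "a \<in> P1" "b \<in> P2"
    then have "card (a \<union> b) = card a + card b"
      using dyadic_parts_Un(2)[OF j, of a k b] finm by (intro card_Un_disjoint) (auto simp: P1_def P2_def)
    then show "x ^ card (a \<union> b) = x ^ card a * x ^ card b" by (simp add: power_add)
  qed
  also have "\<dots> = (\<Sum>a\<in>P1. x ^ card a) * (\<Sum>b\<in>P2. x ^ card b)"
    by (simp add: sum_product sum.cartesian_product)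
  also have "\<dots> \<le> (1/2) * (1/2)"
    unfolding P1_def P2_def using Suc assms(1) by (intro mult_mono Suc.hyps sum_nonneg) auto
  finally show ?case using assms by simp
qed

text \<open>Two dyadic intervals that meet are nested, so each non-empty intersection of blocks is
  itself one of the two blocks. This gives \<open>q \<subseteq> m \<union> m'\<close>, and with it
  the additive bound on the number of blocks.\<close>

lemma dyadic_common_refinement:
  assumes "m \<in> dyadic_partitions N" "m' \<in> dyadic_partitions N"
  obtains q where "q \<in> dyadic_partitions N" "q \<subseteq> m \<union> m'"
    "\<And>K. K \<in> q \<Longrightarrow> (\<exists>I\<in>m. K \<subseteq> I) \<and> (\<exists>J\<in>m'. K \<subseteq> J)"
proof -
  define q where "q = {I \<inter> J | I J. I \<in> m \<and> J \<in> m' \<and> I \<inter> J \<noteq> {}}"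
  have m: "m \<subseteq> dyadic_intervals N" "m' \<subseteq> dyadic_intervals N"
    "partition_on {1..2^N} m" "partition_on {1..2^N} m'"
    using assms by (auto simp: dyadic_partitions_def)
  have sub: "q \<subseteq> m \<union> m'"
  proof
    fix K assume "K \<in> q"
    then obtain I J where K: "K = I \<inter> J" "I \<in> m" "J \<in> m'" "I \<inter> J \<noteq> {}" by (auto simp: q_def)
    then have "I \<subseteq> J \<or> J \<subseteq> I" using dyadic_intervals_nested[of I N J] m by auto
    then show "K \<in> m \<union> m'" using K by (auto simp: Int_absorb1 Int_absorb2)
  qed
  have "\<Union>q = \<Union>m \<inter> \<Union>m'" by (auto simp: q_def)
  then have "\<Union>q = {1..2^N}"
    by (simp only: partition_onD1[OF m(3), symmetric] partition_onD1[OF m(4), symmetric] Int_absorb)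
  moreover have "disjoint q"
    unfolding q_def disjoint_def using disjointD[OF partition_onD2[OF m(3)]] disjointD[OF partition_onD2[OF m(4)]]
    by blast
  moreover have "{} \<notin> q" by (auto simp: q_def)
  ultimately have "partition_on {1..2^N} q" by (simp add: partition_on_def)
  then have "q \<in> dyadic_partitions N" using sub m by (auto simp: dyadic_partitions_def)
  then show ?thesis using sub by (rule that) (auto simp: q_def)
qed

section \<open>Oracle inequality\<close>

lemma fun_sum_apply: "(\<Sum>x\<in>A. f x) i = (\<Sum>x\<in>A. f x i)" for f :: "'a \<Rightarrow> 'b \<Rightarrow> 'c::comm_monoid_add"
  by (induction A rule: infinite_finite_induct) auto

text \<open>One direction is induction over the span; for the other, the value at a chosen point of
  each block serves as the coefficient of its indicator.\<close>

lemma S_space_iff: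
  assumes U: "finite U" and m: "partition_on U m"
  shows "v \<in> S_space m \<longleftrightarrow> (\<forall>i. i \<notin> U \<longrightarrow> v i = 0) \<and> (\<forall>I\<in>m. \<forall>i\<in>I. \<forall>j\<in>I. v i = v j)"
proof
  let ?T = "{v. (\<forall>i. i \<notin> U \<longrightarrow> v i = 0) \<and> (\<forall>I\<in>m. \<forall>i\<in>I. \<forall>j\<in>I. v i = v j)} :: rvec set"
  assume "v \<in> S_space m"
  then have "v \<in> ?T" unfolding S_space_def
  proof (rule fvec.span_subspace_induct)
    show "fvec.subspace ?T"
    proof (rule fvec.subspaceI)
      show "0 \<in> ?T" by simp
    next
      fix x y :: rvec assume "x \<in> ?T" "y \<in> ?T"
      then have "\<forall>i. i \<notin> U \<longrightarrow> x i = 0 \<and> y i = 0" "\<forall>I\<in>m. \<forall>i\<in>I. \<forall>j\<in>I. x i = x j \<and> y i = y j" by blast+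
      then show "x + y \<in> ?T" unfolding mem_Collect_eq plus_fun_apply by (metis add_0)
    next
      fix c :: real and x :: rvec assume "x \<in> ?T"
      then have "\<forall>i. i \<notin> U \<longrightarrow> x i = 0" "\<forall>I\<in>m. \<forall>i\<in>I. \<forall>j\<in>I. x i = x j" by blast+
      then show "fscale c x \<in> ?T" unfolding mem_Collect_eq fscale_def by (metis mult_zero_right)
    qed
  next
    fix w :: rvec assume "w \<in> (\<lambda>I. indicator I) ` m"
    then obtain J where J: "J \<in> m" "w = indicator J" by auto
    have "J \<subseteq> U" using m J by (auto simp: partition_on_def)
    moreover have "indicator J i = (indicator J j :: real)" if "I \<in> m" "i \<in> I" "j \<in> I" for I i j
      using partition_onD2[OF m] J(1) that by (auto simp: disjoint_def indicator_def)
    ultimately show "w \<in> ?T"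
      unfolding J(2) mem_Collect_eq by (metis indicator_simps(2) subsetD)
  qed
  then show "(\<forall>i. i \<notin> U \<longrightarrow> v i = 0) \<and> (\<forall>I\<in>m. \<forall>i\<in>I. \<forall>j\<in>I. v i = v j)" by (rule CollectD)
next
  assume v: "(\<forall>i. i \<notin> U \<longrightarrow> v i = 0) \<and> (\<forall>I\<in>m. \<forall>i\<in>I. \<forall>j\<in>I. v i = v j)"
  have finm: "finite m" by (rule finite_elements[OF U m])
  define c where "c I = v (SOME i. i \<in> I)" for I
  have c: "v i = c I" if "I \<in> m" "i \<in> I" for I i
  proof -
    have "(SOME i. i \<in> I) \<in> I" using that(2) by (rule someI)
    then show ?thesis unfolding c_def using v that by blast
  qed
  have "v = (\<Sum>I\<in>m. fscale (c I) (indicator I))"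
  proof
    fix i
    have *: "(\<Sum>I\<in>m. fscale (c I) (indicator I)) i = (\<Sum>I\<in>m. c I * indicator I i)"
      by (simp add: fun_sum_apply fscale_def)
    show "v i = (\<Sum>I\<in>m. fscale (c I) (indicator I)) i"
    proof (cases "i \<in> U")
      case True
      then obtain K where K: "K \<in> m" "i \<in> K" using m by (auto simp: partition_on_def)
      have "(\<Sum>I\<in>m. c I * indicator I i) = (\<Sum>I\<in>m. if I = K then c K else 0)"
        using partition_onD2[OF m] K by (intro sum.cong) (auto simp: disjoint_def indicator_def)
      then show ?thesis using * finm K c by simp
    next
      case False
      then have "i \<notin> I" if "I \<in> m" for I using m that by (auto simp: partition_on_def)
      then show ?thesis using * v False by simp
    qed
  qed
  moreover have "\<dots> \<in> S_space m"
    unfolding S_space_def by (intro fvec.span_sum fvec.span_scale fvec.span_base) auto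
  ultimately show "v \<in> S_space m" by simp
qed

text \<open>Evaluating a vanishing combination of the indicators at a point of one block isolates
  the coefficient of that block, so the indicators are independent.\<close>

lemma D_dim_eq_card:
  assumes U: "finite U" and m: "partition_on U m"
  shows "D_dim m = card m"
proof -
  have finm: "finite m" by (rule finite_elements[OF U m])
  have inj: "inj_on (\<lambda>I. indicator I :: rvec) m"
    by (rule inj_onI) (metis indicator_eq_1_iff subsetI subset_antisym zero_neq_one)
  have "fvec.independent ((\<lambda>I. indicator I) ` m)"
  proof (rule fvec.independent_if_scalars_zero)
    fix f :: "rvec \<Rightarrow> real" and w :: rvec
    assume z: "(\<Sum>w\<in>(\<lambda>I. indicator I) ` m. fscale (f w) w) = 0" and w: "w \<in> (\<lambda>I. indicator I) ` m"
    obtain K where K: "K \<in> m" "w = indicator K" using w by auto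
    obtain i where i: "i \<in> K" using partition_on_block(2)[OF U m K(1)] by blast
    have "0 = (\<Sum>I\<in>m. fscale (f (indicator I)) (indicator I)) i"
      using z by (simp add: sum.reindex[OF inj])
    also have "\<dots> = (\<Sum>I\<in>m. f (indicator I) * indicator I i)"
      by (simp add: fun_sum_apply fscale_def)
    also have "\<dots> = (\<Sum>I\<in>m. if I = K then f w else 0)"
      using partition_onD2[OF m] K i by (intro sum.cong) (auto simp: disjoint_def indicator_def)
    also have "\<dots> = f w" using finm K by simp
    finally show "f w = 0" by simp
  qed (use finm in simp)
  then show ?thesis
    unfolding D_dim_def S_space_def by (simp add: fvec.dim_eq_card_independent card_image[OF inj])
qed

text \<open>The within-block sum of squares: the contribution of \<open>I\<close> to the
  least-squares residual of \<open>x\<close> on any partition having \<open>I\<close> as a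
  block.\<close>

definition scatter :: "nat \<Rightarrow> rmat \<Rightarrow> nat set \<Rightarrow> real" where
  "scatter r x I = (\<Sum>l=1..r. \<Sum>i\<in>I. (x l i - (\<Sum>i'\<in>I. x l i') / real (card I))\<^sup>2)"

text \<open>The bias-variance identity: the cross term vanishes because deviations from the mean sum
  to zero.\<close>

lemma sum_square_deviation:
  fixes v :: "'a \<Rightarrow> real"
  assumes "finite I" "I \<noteq> {}"
  shows "(\<Sum>i\<in>I. (v i - c)\<^sup>2) =
    (\<Sum>i\<in>I. (v i - (\<Sum>i\<in>I. v i) / real (card I))\<^sup>2) + real (card I) * ((\<Sum>i\<in>I. v i) / real (card I) - c)\<^sup>2"
proof -
  define a where "a = (\<Sum>i\<in>I. v i) / real (card I)"
  have "(\<Sum>i\<in>I. v i - a) = 0" using assms by (simp add: a_def sum_subtractf)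
  then have "(\<Sum>i\<in>I. 2 * (v i - a) * (a - c)) = 0"
    unfolding sum_distrib_left[symmetric] sum_distrib_right[symmetric] by simp
  moreover have "(v i - c)\<^sup>2 = (v i - a)\<^sup>2 + 2 * (v i - a) * (a - c) + (a - c)\<^sup>2" for i
    by (simp add: power2_eq_square algebra_simps)
  ultimately show ?thesis by (simp add: sum.distrib a_def)
qed

section \<open>Least squares on a partition\<close>

lemma mat_norm_square_blocks:
  assumes "partition_on {1..n} m"
  shows "(mat_norm r n t)\<^sup>2 = (\<Sum>I\<in>m. \<Sum>l=1..r. \<Sum>i\<in>I. (t l i)\<^sup>2)"
proof -
  have "(mat_norm r n t)\<^sup>2 = (\<Sum>I\<in>m. \<Sum>i\<in>I. \<Sum>l=1..r. (t l i)\<^sup>2)"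
    unfolding mat_norm_square by (rule sum.partition[OF finite_atLeastAtMost assms])
  also have "\<dots> = (\<Sum>I\<in>m. \<Sum>l=1..r. \<Sum>i\<in>I. (t l i)\<^sup>2)"
    by (rule sum.cong[OF refl], rule sum.swap)
  finally show ?thesis .
qed

lemma tensor_space_const:
  assumes m: "partition_on {1..n} m" and t: "t \<in> tensor_space r n m"
    and "l \<in> {1..r}" "I \<in> m" "i \<in> I" "j \<in> I"
  shows "t l i = t l j"
proof -
  have "t l \<in> S_space m" using t assms(3) by (simp add: tensor_space_def)
  then show ?thesis using assms(4-6) unfolding S_space_iff[OF finite_atLeastAtMost m] by blast
qed

lemma scatter_le_tensor_space:
  assumes m: "partition_on {1..n} m" and t: "t \<in> tensor_space r n m"
  shows "(\<Sum>I\<in>m. scatter r x I) \<le> (mat_norm r n (x - t))\<^sup>2"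
  unfolding mat_norm_square_blocks[OF m] scatter_def
proof (rule sum_mono, rule sum_mono)
  fix I l assume I: "I \<in> m" and l: "l \<in> {1..r}"
  have fin: "finite I" "I \<noteq> {}" using partition_on_block[OF _ m I] by auto
  obtain j where j: "j \<in> I" using fin by auto
  have "(\<Sum>i\<in>I. ((x - t) l i)\<^sup>2) = (\<Sum>i\<in>I. (x l i - t l j)\<^sup>2)"
    using tensor_space_const[OF m t l I _ j] by (intro sum.cong) auto
  then show "(\<Sum>i\<in>I. (x l i - (\<Sum>i'\<in>I. x l i') / real (card I))\<^sup>2) \<le> (\<Sum>i\<in>I. ((x - t) l i)\<^sup>2)"
    using sum_square_deviation[OF fin, of "x l" "t l j"] by simp
qed

text \<open>The matrix of block averages attains the lower bound of
  \<open>scatter_le_tensor_space\<close>, so the total scatter is the squared distance to the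
  model.\<close>

lemma scatter_attained:
  assumes m: "partition_on {1..n} m"
  obtains t where "t \<in> tensor_space r n m" "(mat_norm r n (x - t))\<^sup>2 = (\<Sum>I\<in>m. scatter r x I)"
proof -
  define t where "t l i = (if l \<in> {1..r} \<and> i \<in> {1..n}
    then (\<Sum>i'\<in>(THE I. I \<in> m \<and> i \<in> I). x l i') / real (card (THE I. I \<in> m \<and> i \<in> I)) else 0)" for l i
  have the: "(THE I. I \<in> m \<and> i \<in> I) = I" if "I \<in> m" "i \<in> I" for I i
    using partition_onD2[OF m] that by (intro the_equality) (auto simp: disjoint_def)
  have sub: "i \<in> {1..n}" if "I \<in> m" "i \<in> I" for I i using m that by (auto simp: partition_on_def)
  have t: "t l i = (\<Sum>i'\<in>I. x l i') / real (card I)" if "l \<in> {1..r}" "I \<in> m" "i \<in> I" for l I i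
    using that sub[OF that(2,3)] by (simp add: t_def the)
  show ?thesis
  proof (rule that)
    show "t \<in> tensor_space r n m"
      unfolding tensor_space_def S_space_iff[OF finite_atLeastAtMost m]
      by (auto simp: Mat_def t simp del: atLeastAtMost_iff) (auto simp: t_def split: if_splits)
    show "(mat_norm r n (x - t))\<^sup>2 = (\<Sum>I\<in>m. scatter r x I)"
      unfolding mat_norm_square_blocks[OF m] scatter_def by (intro sum.cong refl) (simp add: t)
  qed
qed

text \<open>\<open>ARG_MIN\<close> is a choice operator and says nothing until a minimizer is known
  to exist; block averages supply one.\<close>

lemma proj_est_is_arg_min:
  assumes m: "partition_on {1..n} m"
  shows "proj_est r n m y \<in> tensor_space r n m"
    and "t \<in> tensor_space r n m \<Longrightarrow>
      (mat_norm r n (obs_mat r n y - proj_est r n m y))\<^sup>2 \<le> (mat_norm r n (obs_mat r n y - t))\<^sup>2"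
proof -
  let ?f = "\<lambda>t. (mat_norm r n (obs_mat r n y - t))\<^sup>2"
  obtain t0 where "t0 \<in> tensor_space r n m" "?f t0 = (\<Sum>I\<in>m. scatter r (obs_mat r n y) I)"
    by (rule scatter_attained[OF m])
  then have "is_arg_min ?f (\<lambda>t. t \<in> tensor_space r n m) t0"
    using scatter_le_tensor_space[OF m] by (simp add: is_arg_min_linorder)
  then have "is_arg_min ?f (\<lambda>t. t \<in> tensor_space r n m) (proj_est r n m y)"
    unfolding proj_est_def arg_min_def by (rule someI[of "is_arg_min ?f (\<lambda>t. t \<in> tensor_space r n m)"])
  then show "proj_est r n m y \<in> tensor_space r n m"
    and "t \<in> tensor_space r n m \<Longrightarrow> ?f (proj_est r n m y) \<le> ?f t"
    by (auto simp: is_arg_min_linorder)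
qed

text \<open>On a block of size c where \<open>u\<close> has the value w, the cross term is 2 S w
  with S the block noise, and (4 S - c w)^2 \<ge> 0 bounds it. The weight 1/4 on the norm of
  \<open>u\<close> is small enough for half of the loss to survive the later absorption.\<close>

lemma noise_cross_term_le:
  assumes q: "partition_on {1..n} q"
    and u: "\<And>l I i j. l \<in> {1..r} \<Longrightarrow> I \<in> q \<Longrightarrow> i \<in> I \<Longrightarrow> j \<in> I \<Longrightarrow> u l i = u l j"
  shows "2 * (\<Sum>i=1..n. \<Sum>l=1..r. (of_bool (y i = l) - s l i) * u l i)
     \<le> 4 * noise_stat r s q y + (mat_norm r n u)\<^sup>2 / 4"
proof -
  have "2 * (\<Sum>i=1..n. \<Sum>l=1..r. (of_bool (y i = l) - s l i) * u l i)
    = (\<Sum>I\<in>q. \<Sum>l=1..r. 2 * (\<Sum>i\<in>I. (of_bool (y i = l) - s l i) * u l i))"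
  proof -
    have "(\<Sum>i=1..n. \<Sum>l=1..r. (of_bool (y i = l) - s l i) * u l i)
      = (\<Sum>I\<in>q. \<Sum>i\<in>I. \<Sum>l=1..r. (of_bool (y i = l) - s l i) * u l i)"
      by (rule sum.partition[OF finite_atLeastAtMost q])
    also have "\<dots> = (\<Sum>I\<in>q. \<Sum>l=1..r. \<Sum>i\<in>I. (of_bool (y i = l) - s l i) * u l i)"
      by (rule sum.cong[OF refl], rule sum.swap)
    finally show ?thesis by (simp only: sum_distrib_left)
  qed
  also have "\<dots> \<le> (\<Sum>I\<in>q. \<Sum>l=1..r. 4 * ((\<Sum>i\<in>I. of_bool (y i = l) - s l i)\<^sup>2 / real (card I)) + (\<Sum>i\<in>I. (u l i)\<^sup>2) / 4)"
  proof (intro sum_mono)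
    fix I l assume I: "I \<in> q" and l: "l \<in> {1..r}"
    have fin: "finite I" "I \<noteq> {}" using partition_on_block[OF _ q I] by auto
    obtain j where j: "j \<in> I" using fin by auto
    define S where "S = (\<Sum>i\<in>I. of_bool (y i = l) - s l i)"
    define c where "c = real (card I)"
    define w where "w = u l j"
    have c0: "c > 0" using fin by (simp add: c_def card_gt_0_iff)
    have "0 \<le> (4 * S - c * w)\<^sup>2" by simp
    then have "8 * (c * (S * w)) \<le> 16 * S\<^sup>2 + c\<^sup>2 * w\<^sup>2"
      by (simp add: power2_eq_square algebra_simps)
    then have "2 * (S * w) \<le> 4 * (S\<^sup>2 / c) + c * w\<^sup>2 / 4"
      using c0 by (simp add: field_simps power2_eq_square)
    moreover have "(\<Sum>i\<in>I. (of_bool (y i = l) - s l i) * u l i) = S * w"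
      unfolding S_def w_def sum_distrib_right using u[OF l I _ j] by (intro sum.cong) auto
    moreover have "(\<Sum>i\<in>I. (u l i)\<^sup>2) = c * w\<^sup>2"
      unfolding c_def w_def using u[OF l I _ j] by simp
    ultimately show "2 * (\<Sum>i\<in>I. (of_bool (y i = l) - s l i) * u l i)
      \<le> 4 * ((\<Sum>i\<in>I. of_bool (y i = l) - s l i)\<^sup>2 / real (card I)) + (\<Sum>i\<in>I. (u l i)\<^sup>2) / 4"
      by (simp add: S_def c_def)
  qed
  also have "\<dots> = 4 * noise_stat r s q y + (mat_norm r n u)\<^sup>2 / 4"
    unfolding noise_stat_def mat_norm_square_blocks[OF q]
    by (simp add: sum.distrib sum_distrib_left sum_divide_distrib)
  finally show ?thesis .
qed

text \<open>A majorant, simultaneously in \<open>m\<close>, of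
  \<open>noise_stat r s m y - 32 * card m\<close>. The supremum over partitions is replaced by a sum
  through z \<le> 16 exp(z/16), so its expectation reduces to exponential moments.\<close>

definition noise_excess :: "nat \<Rightarrow> nat \<Rightarrow> rmat \<Rightarrow> (nat \<Rightarrow> nat) \<Rightarrow> real" where
  "noise_excess r N s y =
     (\<Sum>m\<in>dyadic_partitions N. 16 * exp ((noise_stat r s m y - 32 * real (card m)) / 16))"

lemma finite_dyadic_partitions: "finite (dyadic_partitions N)"
  by (simp add: dyadic_partitions_eq finite_dyadic_parts)

lemma partition_on_dyadic_partitions: "m \<in> dyadic_partitions N \<Longrightarrow> partition_on {1..2^N} m"
  by (simp add: dyadic_partitions_def)

lemma noise_stat_le_excess:
  assumes "m \<in> dyadic_partitions N"
  shows "noise_stat r s m y \<le> 32 * real (card m) + noise_excess r N s y"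
proof -
  let ?f = "\<lambda>m. 16 * exp ((noise_stat r s m y - 32 * real (card m)) / 16)"
  have "(noise_stat r s m y - 32 * real (card m)) / 16 \<le> exp ((noise_stat r s m y - 32 * real (card m)) / 16)"
    using exp_ge_add_one_self[of "(noise_stat r s m y - 32 * real (card m)) / 16"] by linarith
  then have "noise_stat r s m y - 32 * real (card m) \<le> ?f m" by simp
  also have "\<dots> \<le> noise_excess r N s y"
    unfolding noise_excess_def using finite_dyadic_partitions assms by (intro member_le_sum) auto
  finally show ?thesis by simp
qed

text \<open>The moment bound exp(|m|/4) against the weight exp(-2|m|) leaves x^|m| with x =
  exp(-7/4) \<le> 1/4. The counting bound 1/2 times the factor 16 is 8.\<close>

lemma expect_noise_excess:
  assumes s: "s \<in> prob_mats r (2^N)"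
  shows "prod_expect r s {1..2^N} (noise_excess r N s) \<le> 8"
proof -
  define x where "x = exp (- (7/4) :: real)"
  have x: "0 \<le> x" "x \<le> 1/4"
  proof -
    \<comment> \<open>At half of 7/4 the quadratic Taylor bound is already above 2; squaring then
      gives 4 \<le> exp(7/4).\<close>
    have "2 \<le> exp (7/8 :: real)" using exp_lower_Taylor_quadratic[of "7/8::real"] by (simp add: power2_eq_square)
    then have "2 * 2 \<le> exp (7/8 :: real) * exp (7/8)" by (intro mult_mono) auto
    then have "4 \<le> exp (7/4 :: real)" by (simp flip: exp_add)
    then show "x \<le> 1/4" unfolding x_def exp_minus by (simp add: field_simps)
  qed (simp add: x_def)
  have "prod_expect r s {1..2^N} (noise_excess r N s)
      = (\<Sum>m\<in>dyadic_partitions N. 16 * exp (- 2 * real (card m)) *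
           prod_expect r s {1..2^N} (\<lambda>y. exp (noise_stat r s m y / 16)))"
    unfolding noise_excess_def prod_expect_sum prod_expect_cmult[symmetric]
  proof (rule sum.cong[OF refl])
    fix m
    have "16 * exp ((noise_stat r s m y - 32 * real (card m)) / 16)
        = 16 * exp (- 2 * real (card m)) * exp (noise_stat r s m y / 16)" for y
    proof -
      have "(noise_stat r s m y - 32 * real (card m)) / 16 = - 2 * real (card m) + noise_stat r s m y / 16"
        by (simp add: diff_divide_distrib)
      then show ?thesis by (simp only: exp_add mult.assoc)
    qed
    then show "prod_expect r s {1..2^N} (\<lambda>y. 16 * exp ((noise_stat r s m y - 32 * real (card m)) / 16))
      = prod_expect r s {1..2^N} (\<lambda>y. 16 * exp (- 2 * real (card m)) * exp (noise_stat r s m y / 16))"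
      by presburger
  qed
  also have "\<dots> \<le> (\<Sum>m\<in>dyadic_partitions N. 16 * x ^ card m)"
  proof (rule sum_mono)
    fix m assume "m \<in> dyadic_partitions N"
    then have m: "partition_on {1..2^N} m" by (rule partition_on_dyadic_partitions)
    have "prod_expect r s {1..2^N} (\<lambda>y. exp (noise_stat r s m y / 16)) \<le> exp (real (card m) / 4)"
      using s by (intro exp_moment_noise_stat[OF _ _ _ m]) (auto simp: prob_mats_def)
    then have "16 * exp (- 2 * real (card m)) * prod_expect r s {1..2^N} (\<lambda>y. exp (noise_stat r s m y / 16))
       \<le> 16 * exp (- 2 * real (card m)) * exp (real (card m) / 4)"
      by (intro mult_left_mono) auto
    also have "\<dots> = 16 * exp (real (card m) * - (7/4))"
      by (simp add: mult.assoc flip: exp_add)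
    also have "\<dots> = 16 * x ^ card m"
      unfolding x_def by (simp only: exp_of_nat_mult)
    finally show "16 * exp (- 2 * real (card m)) * prod_expect r s {1..2^N} (\<lambda>y. exp (noise_stat r s m y / 16))
       \<le> 16 * x ^ card m" .
  qed
  also have "\<dots> = 16 * (\<Sum>m\<in>dyadic_parts N 0 0. x ^ card m)"
    by (simp add: dyadic_partitions_eq sum_distrib_left)
  also have "\<dots> \<le> 16 * (1/2)"
    using x by (intro mult_left_mono sum_power_card_dyadic_parts) auto
  finally show ?thesis by simp
qed

text \<open>A deterministic comparison for each outcome, valid for whichever minimizer the selector
  picks. The selection is controlled through \<open>noise_excess\<close>, which bounds the noise on
  all dyadic partitions at once.\<close>

lemma oracle_pathwise:
  assumes mhat: "is_selector c0 r N mhat" and c0: "128 \<le> c0"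
    and y: "y \<in> PiE {1..2^N} (\<lambda>_. {1..r})"
    and m: "m \<in> dyadic_partitions N" and t: "t \<in> tensor_space r (2^N) m"
  shows "(mat_norm r (2^N) (s - prelim_est r (2^N) mhat y))\<^sup>2
     \<le> 3 * (mat_norm r (2^N) (s - t))\<^sup>2 + 2 * (c0 + 128) * real (card m) + 8 * noise_excess r N s y"
proof -
  define n where "n = (2::nat)^N"
  define h where "h = mhat y"
  define e where "e = prelim_est r n mhat y"
  define X where "X = obs_mat r n y"
  define Q where "Q t = (mat_norm r n t)\<^sup>2" for t
  have "y \<in> space (sample_space r (2^N))" using y by (simp add: sample_space_def space_PiM)
  then have "is_arg_min (pen_crit c0 r n y) (\<lambda>m. m \<in> dyadic_partitions N) h"
    using mhat by (simp add: is_selector_def h_def n_def)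
  then have h: "h \<in> dyadic_partitions N" and min: "pen_crit c0 r n y h \<le> pen_crit c0 r n y m"
    using m by (auto simp: is_arg_min_linorder)
  have ph: "partition_on {1..n} h" and pm: "partition_on {1..n} m"
    using partition_on_dyadic_partitions h m by (auto simp: n_def)
  have e_eq: "e = proj_est r n h y" by (simp add: e_def prelim_est_def h_def)
  have e: "e \<in> tensor_space r n h" unfolding e_eq by (rule proj_est_is_arg_min(1)[OF ph])
  have t': "t \<in> tensor_space r n m" using t by (simp add: n_def)
  have "Q (X - e) + c0 * real (card h) \<le> Q (X - proj_est r n m y) + c0 * real (card m)"
    using min unfolding pen_crit_def pen_def D_dim_eq_card[OF finite_atLeastAtMost ph]
      D_dim_eq_card[OF finite_atLeastAtMost pm] by (simp add: e_eq X_def Q_def)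
  moreover have "Q (X - proj_est r n m y) \<le> Q (X - t)"
    unfolding X_def Q_def by (rule proj_est_is_arg_min(2)[OF pm t'])
  ultimately have 1: "Q (X - e) + c0 * real (card h) \<le> Q (X - t) + c0 * real (card m)" by simp
  define Z where "Z u = (\<Sum>i=1..n. \<Sum>l=1..r. (of_bool (y i = l) - s l i) * u l i)" for u
  define E where "E = (\<Sum>i=1..n. \<Sum>l=1..r. (of_bool (y i = l) - s l i)\<^sup>2 :: real)"
  \<comment> \<open>The pure noise energy \<open>E\<close> does not depend on the candidate
    \<open>u\<close> and cancels when \<open>e\<close> is compared with \<open>t\<close>.\<close>
  have expand: "Q (X - u) = Q (s - u) + 2 * Z (s - u) + E" for u
  proof -
    have "Q (X - u) = (\<Sum>i=1..n. \<Sum>l=1..r. ((s - u) l i)\<^sup>2 + 2 * ((of_bool (y i = l) - s l i) * (s - u) l i) + (of_bool (y i = l) - s l i)\<^sup>2)"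
      unfolding Q_def mat_norm_square
      by (intro sum.cong refl) (auto simp: X_def obs_mat_def power2_eq_square algebra_simps)
    then show ?thesis by (simp add: Q_def mat_norm_square Z_def E_def sum.distrib sum_distrib_left)
  qed
  have "Z (s - t) - Z (s - e) = Z (e - t)"
    by (simp add: Z_def algebra_simps flip: sum_subtractf)
  then have 2: "Q (s - e) \<le> Q (s - t) + 2 * Z (e - t) + c0 * real (card m) - c0 * real (card h)"
    using 1 expand[of e] expand[of t] by linarith
  \<comment> \<open>Both \<open>t\<close> and \<open>e\<close> are constant on the blocks of
    \<open>q\<close>, so the cross term for \<open>e - t\<close> can be controlled there.\<close>
  obtain q where q: "q \<in> dyadic_partitions N" "q \<subseteq> m \<union> h"
      "\<And>K. K \<in> q \<Longrightarrow> (\<exists>I\<in>m. K \<subseteq> I) \<and> (\<exists>J\<in>h. K \<subseteq> J)"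
    using dyadic_common_refinement[OF m h] by blast
  have pq: "partition_on {1..n} q" using partition_on_dyadic_partitions q by (auto simp: n_def)
  have a1: "2 * Z (e - t) \<le> 4 * noise_stat r s q y + Q (e - t) / 4"
    unfolding Z_def Q_def
  proof (rule noise_cross_term_le[OF pq])
    fix l K i j assume l: "l \<in> {1..r}" and K: "K \<in> q" "i \<in> K" "j \<in> K"
    obtain I J where "I \<in> m" "K \<subseteq> I" "J \<in> h" "K \<subseteq> J" using q(3)[OF K(1)] by auto
    then have "t l i = t l j" "e l i = e l j"
      using K tensor_space_const[OF pm t' l, of I i j] tensor_space_const[OF ph e l, of J i j] by auto
    then show "(e - t) l i = (e - t) l j" by simp
  qed
  have a2: "Q (e - t) \<le> 2 * Q (s - e) + 2 * Q (s - t)"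
  proof -
    have "Q (e - t) \<le> (\<Sum>i=1..n. \<Sum>l=1..r. 2 * ((s - e) l i)\<^sup>2 + 2 * ((s - t) l i)\<^sup>2)"
      unfolding Q_def mat_norm_square
    proof (intro sum_mono)
      fix i l
      have "0 \<le> ((s - e) l i + (s - t) l i)\<^sup>2" by simp
      then show "((e - t) l i)\<^sup>2 \<le> 2 * ((s - e) l i)\<^sup>2 + 2 * ((s - t) l i)\<^sup>2"
        by (simp add: power2_eq_square algebra_simps)
    qed
    then show ?thesis by (simp add: Q_def mat_norm_square sum.distrib sum_distrib_left)
  qed
  have a3: "noise_stat r s q y \<le> 32 * (real (card m) + real (card h)) + noise_excess r N s y"
  proof -
    have "card q \<le> card m + card h"
      using card_mono[OF _ q(2)] card_Un_le[of m h] finite_elements[OF finite_atLeastAtMost pm]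
        finite_elements[OF finite_atLeastAtMost ph] by simp
    then have "real (card q) \<le> real (card m) + real (card h)" by (metis of_nat_add of_nat_mono)
    then show ?thesis using noise_stat_le_excess[OF q(1), of r s y] unfolding distrib_left by linarith
  qed
  \<comment> \<open>The factor 4 of the cross term times the factor 32 of the excess gives the 128
    that the penalty of the selected partition has to dominate.\<close>
  have a4: "128 * real (card h) \<le> c0 * real (card h)"
    using c0 by (intro mult_right_mono) auto
  \<comment> \<open>By \<open>a1\<close> and \<open>a2\<close>, half of \<open>Q (s - e)\<close> and
    half of \<open>Q (s - t)\<close> appear on the right. Moving the former to the left and doubling
    gives the constants 3, 2 and 8.\<close>
  have "Q (s - e) \<le> 3 * Q (s - t) + 2 * (c0 * real (card m) + 128 * real (card m)) + 8 * noise_excess r N s y"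
    using 2 a1 a2 a3 a4 unfolding distrib_left by linarith
  then have "Q (s - e) \<le> 3 * Q (s - t) + 2 * (c0 + 128) * real (card m) + 8 * noise_excess r N s y"
    by (simp only: distrib_left distrib_right mult.assoc)
  then show ?thesis by (simp only: Q_def e_def n_def)
qed

text \<open>The pathwise bound at the block averages of \<open>s\<close> on \<open>m\<close>,
  integrated; the constant 64 is the factor 8 times the bound 8 on the expected excess.\<close>

lemma oracle_inequality:
  assumes s: "s \<in> prob_mats r (2^N)" and mhat: "is_selector c0 r N mhat" and c0: "128 \<le> c0"
    and m: "m \<in> dyadic_partitions N"
  shows "risk r (2^N) s (prelim_est r (2^N) mhat)
     \<le> ennreal (3 * (\<Sum>I\<in>m. scatter r s I) + 2 * (c0 + 128) * real (card m) + 64)"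
proof -
  have pm: "partition_on {1..2^N} m" by (rule partition_on_dyadic_partitions[OF m])
  obtain t where t: "t \<in> tensor_space r (2^N) m" "(mat_norm r (2^N) (s - t))\<^sup>2 = (\<Sum>I\<in>m. scatter r s I)"
    by (rule scatter_attained[OF pm])
  let ?B = "3 * (\<Sum>I\<in>m. scatter r s I) + 2 * (c0 + 128) * real (card m)"
  have "prod_expect r s {1..2^N} (\<lambda>y. (mat_norm r (2^N) (s - prelim_est r (2^N) mhat y))\<^sup>2)
     \<le> prod_expect r s {1..2^N} (\<lambda>y. ?B + 8 * noise_excess r N s y)"
  proof (rule prod_expect_mono)
    fix y :: "nat \<Rightarrow> nat" assume "y \<in> PiE {1..2^N} (\<lambda>_. {1..r})"
    from oracle_pathwise[OF mhat c0 this m t(1), of s]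
    show "(mat_norm r (2^N) (s - prelim_est r (2^N) mhat y))\<^sup>2 \<le> ?B + 8 * noise_excess r N s y"
      by (simp only: t(2))
  qed (use s in \<open>auto simp: prob_mats_def\<close>)
  also have "\<dots> = ?B + 8 * prod_expect r s {1..2^N} (noise_excess r N s)"
  proof -
    have "prod_expect r s {1..2^N} (\<lambda>_. ?B) = ?B"
      using s by (intro prod_expect_const) (auto simp: prob_mats_def)
    then show ?thesis by (simp only: prod_expect_add prod_expect_cmult)
  qed
  also have "\<dots> \<le> ?B + 64" using expect_noise_excess[OF s] by simp
  finally show ?thesis unfolding risk_eq_prod_expect[OF s] by (rule ennreal_leI)
qed

section \<open>Approximation in Besov bodies\<close>

definition haar_energy :: "nat \<Rightarrow> nat \<Rightarrow> rmat \<Rightarrow> nat \<Rightarrow> nat \<Rightarrow> real" where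
  "haar_energy r N s j k = (\<Sum>l=1..r. (haar_coeff (2^N) s j k l)\<^sup>2)"

text \<open>With \<open>M\<close> the length of a half block, the half-open intervals (0, 1/2] and
  (1/2, 1] of the mother function correspond exactly to the two integer half blocks, which begin one
  past a multiple of \<open>M\<close>.\<close>

lemma haar_eq_indicator:
  assumes "j < N"
  shows "haar (2^N) j k i = 2 powr (real j / 2) / sqrt (2^N) *
     (indicator (dyad N (Suc j) (2*k)) i - indicator (dyad N (Suc j) (2*k+1)) i)"
proof -
  define M where "M = (2::nat)^(N - Suc j)"
  have M0: "M > 0" by (simp add: M_def)
  have N: "(2::nat)^N = 2^j * (2 * M)"
    using assms by (simp add: M_def flip: power_Suc power_add)
  define z where "z = real i / (2 * real M) - real k"
  have z: "2^j * (real i / real (2^N)) - real k = z"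
    unfolding N z_def by simp
  have a: "0 < z \<longleftrightarrow> 2*k*M < i"
  proof -
    have "0 < z \<longleftrightarrow> real (2*k*M) < real i" using M0 by (simp add: z_def field_simps)
    then show ?thesis by (simp only: of_nat_less_iff)
  qed
  have b: "z \<le> 1/2 \<longleftrightarrow> i \<le> (2*k+1)*M"
  proof -
    have "z \<le> 1/2 \<longleftrightarrow> real i / (2 * real M) \<le> 1/2 + real k" by (auto simp: z_def)
    also have "\<dots> \<longleftrightarrow> real i \<le> (1/2 + real k) * (2 * real M)" using M0 by (simp add: pos_divide_le_eq)
    also have "(1/2 + real k) * (2 * real M) = real ((2*k+1)*M)" by (simp add: algebra_simps)
    finally show ?thesis by (simp only: of_nat_le_iff)
  qed
  have c: "z \<le> 1 \<longleftrightarrow> i \<le> (2*k+2)*M"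
  proof -
    have "z \<le> 1 \<longleftrightarrow> real i / (2 * real M) \<le> 1 + real k" by (auto simp: z_def)
    also have "\<dots> \<longleftrightarrow> real i \<le> (1 + real k) * (2 * real M)" using M0 by (simp add: pos_divide_le_eq)
    also have "(1 + real k) * (2 * real M) = real ((2*k+2)*M)" by (simp add: algebra_simps)
    finally show ?thesis by (simp only: of_nat_le_iff)
  qed
  have d: "dyad N (Suc j) (2*k) = {2*k*M+1..(2*k+1)*M}" "dyad N (Suc j) (2*k+1) = {(2*k+1)*M+1..(2*k+2)*M}"
    by (simp_all add: dyad_def M_def)
  have "2*k*M \<le> (2*k+1)*M" "(2*k+1)*M \<le> (2*k+2)*M" by simp_all
  then have "haar_mother z = indicator (dyad N (Suc j) (2*k)) i - indicator (dyad N (Suc j) (2*k+1)) i"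
    unfolding haar_mother_def d indicator_def using a b c by auto
  then show ?thesis unfolding haar_def z by simp
qed

lemma dyad_subset_root: "j \<le> N \<Longrightarrow> k < 2^j \<Longrightarrow> dyad N j k \<subseteq> {1..2^N}"
  using dyad_subset_ancestor[of 0 j N k] by (simp add: dyad_root)

lemma haar_coeff_eq:
  assumes "j < N" "k < 2^j"
  shows "haar_coeff (2^N) t j k l = 2 powr (real j / 2) / sqrt (2^N) *
     ((\<Sum>i\<in>dyad N (Suc j) (2*k). t l i) - (\<Sum>i\<in>dyad N (Suc j) (2*k+1). t l i))"
proof -
  have sub: "dyad N (Suc j) (2*k) \<subseteq> {1..2^N}" "dyad N (Suc j) (2*k+1) \<subseteq> {1..2^N}"
    using assms by (intro dyad_subset_root; simp)+
  have ind: "(\<Sum>i=1..2^N. t l i * indicator A i) = (\<Sum>i\<in>A. t l i)" if "A \<subseteq> {1..2^N}" for A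
    using that by (intro sum.mono_neutral_cong_right) (auto simp: indicator_def)
  have "haar_coeff (2^N) t j k l = 2 powr (real j / 2) / sqrt (2^N) *
      ((\<Sum>i=1..2^N. t l i * indicator (dyad N (Suc j) (2*k)) i) - (\<Sum>i=1..2^N. t l i * indicator (dyad N (Suc j) (2*k+1)) i))"
  proof -
    have "(\<Sum>i=1..2^N. t l i * (c * (f i - g i))) = c * ((\<Sum>i=1..2^N. t l i * f i) - (\<Sum>i=1..2^N. t l i * g i))"
      for c :: real and f g :: rvec
      by (simp add: sum_subtractf[symmetric] sum_distrib_left algebra_simps)
    then show ?thesis unfolding haar_coeff_def vec_inner_def haar_eq_indicator[OF assms(1)] .
  qed
  then show ?thesis by (simp only: ind[OF sub(1)] ind[OF sub(2)])
qed

text \<open>For blocks of equal size the common mean is the midpoint of the two means. Two uses of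
  \<open>sum_square_deviation\<close> leave the between-block term (SA - SB)^2 / (2a).\<close>

lemma scatter_Un:
  assumes "finite A" "finite B" "A \<inter> B = {}" "card A = a" "card B = a" "a > 0"
  shows "scatter r x (A \<union> B) = scatter r x A + scatter r x B
     + (\<Sum>l=1..r. ((\<Sum>i\<in>A. x l i) - (\<Sum>i\<in>B. x l i))\<^sup>2 / (2 * real a))"
proof -
  have ne: "A \<noteq> {}" "B \<noteq> {}" using assms by auto
  have cU: "card (A \<union> B) = 2 * a" using assms by (simp add: card_Un_disjoint)
  have "(\<Sum>i\<in>A \<union> B. (x l i - (\<Sum>i'\<in>A \<union> B. x l i') / real (card (A \<union> B)))\<^sup>2)
     = (\<Sum>i\<in>A. (x l i - (\<Sum>i'\<in>A. x l i') / real (card A))\<^sup>2)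
     + (\<Sum>i\<in>B. (x l i - (\<Sum>i'\<in>B. x l i') / real (card B))\<^sup>2)
     + ((\<Sum>i\<in>A. x l i) - (\<Sum>i\<in>B. x l i))\<^sup>2 / (2 * real a)" for l
  proof -
    define SA where "SA = (\<Sum>i\<in>A. x l i)"
    define SB where "SB = (\<Sum>i\<in>B. x l i)"
    define c where "c = (SA + SB) / (2 * real a)"
    have SU: "(\<Sum>i'\<in>A \<union> B. x l i') / real (card (A \<union> B)) = c"
      using assms by (simp add: cU c_def SA_def SB_def sum.union_disjoint)
    have "real a * (SA / real a - c)\<^sup>2 + real a * (SB / real a - c)\<^sup>2 = (SA - SB)\<^sup>2 / (2 * real a)"
      using assms(6) by (simp add: c_def field_simps power2_eq_square)
    moreover have "(\<Sum>i\<in>A \<union> B. (x l i - c)\<^sup>2) = (\<Sum>i\<in>A. (x l i - c)\<^sup>2) + (\<Sum>i\<in>B. (x l i - c)\<^sup>2)"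
      using assms by (intro sum.union_disjoint) auto
    ultimately show ?thesis
      unfolding SU using sum_square_deviation[OF assms(1) ne(1), of "x l" c]
        sum_square_deviation[OF assms(2) ne(2), of "x l" c] assms(4,5)
      by (simp add: SA_def SB_def)
  qed
  then show ?thesis by (simp add: scatter_def sum.distrib)
qed

text \<open>The squared Haar amplitude 2^j / 2^N equals 1 / (2a), so the between-block term of the
  two halves is precisely the energy of one Haar coefficient.\<close>

lemma scatter_dyad_split:
  assumes "j < N" "k < 2^j"
  shows "scatter r s (dyad N j k) =
    scatter r s (dyad N (Suc j) (2*k)) + scatter r s (dyad N (Suc j) (2*k+1)) + haar_energy r N s j k"
proof -
  define a where "a = (2::nat)^(N - Suc j)"
  have N: "(2::real)^N = 2^j * (2 * real a)"
    using assms by (simp add: a_def flip: power_Suc power_add)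
  have "(2 powr (real j / 2) / sqrt (2^N))\<^sup>2 = 1 / (2 * real a)"
  proof -
    have "(2 powr (real j / 2))\<^sup>2 = (2::real)^j"
      by (simp add: power2_eq_square powr_realpow flip: powr_add)
    then show ?thesis using N by (simp add: power_divide)
  qed
  then have "haar_energy r N s j k = (\<Sum>l=1..r. ((\<Sum>i\<in>dyad N (Suc j) (2*k). s l i) - (\<Sum>i\<in>dyad N (Suc j) (2*k+1). s l i))\<^sup>2 / (2 * real a))"
    unfolding haar_energy_def haar_coeff_eq[OF assms] power_mult_distrib by simp
  then show ?thesis
    unfolding dyad_split(1)[OF assms(1), of k]
    using scatter_Un[OF finite_dyad finite_dyad dyad_split(2)[OF assms(1), of k], of a r s]
    by (simp add: card_dyad a_def)
qed

text \<open>\<open>below N j k\<close> indexes the Haar functions supported in the dyadic interval \<open>dyad N j k\<close>.\<close>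

definition below :: "nat \<Rightarrow> nat \<Rightarrow> nat \<Rightarrow> (nat \<times> nat) set" where
  "below N j k = {(j', k'). j \<le> j' \<and> j' < N \<and> k' div 2^(j'-j) = k}"

lemma below_leaf: "below N N k = {}"
  by (auto simp: below_def)

lemma below_split:
  assumes "j < N"
  shows "below N j k = insert (j,k) (below N (Suc j) (2*k) \<union> below N (Suc j) (2*k+1))"
    and "below N (Suc j) (2*k) \<inter> below N (Suc j) (2*k+1) = {}"
    and "(j,k) \<notin> below N (Suc j) (2*k) \<union> below N (Suc j) (2*k+1)"
proof -
  show "below N j k = insert (j,k) (below N (Suc j) (2*k) \<union> below N (Suc j) (2*k+1))"
  proof (rule set_eqI)
    fix v :: "nat \<times> nat"
    obtain j' k' where v: "v = (j', k')" by (cases v)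
    have "(x::nat) div 2 = k \<longleftrightarrow> x = 2*k \<or> x = 2*k+1" for x by auto
    then have "k' div 2^(j'-j) = k \<longleftrightarrow> k' div 2^(j'-Suc j) = 2*k \<or> k' div 2^(j'-Suc j) = 2*k+1" if "j < j'"
      using that by (simp add: Suc_diff_Suc[symmetric] div_mult2_eq power_Suc2 del: power_Suc)
    then show "v \<in> below N j k \<longleftrightarrow> v \<in> insert (j,k) (below N (Suc j) (2*k) \<union> below N (Suc j) (2*k+1))"
      using assms by (cases "j' = j"; cases "j < j'") (auto simp: v below_def)
  qed
qed (auto simp: below_def)

lemma finite_below: "finite (below N j k)"
proof -
  have "below N j k \<subseteq> (SIGMA j':{..<N}. {..<(k+1) * 2^(j'-j)})"
    by (auto simp: below_def) (metis dividend_less_div_times mult.commute add.commute mult_Suc zero_less_power zero_less_numeral)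
  then show ?thesis by (rule finite_subset) simp
qed

text \<open>A local Parseval identity, obtained by splitting down to singletons, where the scatter
  is zero.\<close>

lemma scatter_eq_sum_energy:
  assumes "j \<le> N" "k < 2^j"
  shows "scatter r s (dyad N j k) = (\<Sum>(j',k')\<in>below N j k. haar_energy r N s j' k')"
  using assms
proof (induction "N - j" arbitrary: j k)
  case 0
  then have "j = N" by simp
  then show ?case by (simp add: dyad_leaf below_leaf scatter_def)
next
  case (Suc d)
  then have j: "j < N" by simp
  show ?case
    unfolding scatter_dyad_split[OF j Suc.prems(2)] below_split(1)[OF j]
    using Suc below_split[OF j, of k] finite_below by (simp add: sum.union_disjoint)
qed

lemma haar_energy_nonneg: "0 \<le> haar_energy r N s j k"
  by (simp add: haar_energy_def sum_nonneg)

text \<open>\<open>K\<close> is the set of coefficients to be kept. A node is split as long as some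
  coefficient of \<open>K\<close> lies at or below it; a binary tree has one leaf more than internal
  nodes, whence the bound on the number of blocks. At a node where splitting stops, the scatter is
  energy outside \<open>K\<close>.\<close>

lemma tree_partition_exists:
  assumes "j \<le> N" "k < 2^j"
  shows "\<exists>m\<in>dyadic_parts N j k.
     card m \<le> 1 + card {v \<in> below N j k. below N (fst v) (snd v) \<inter> K \<noteq> {}} \<and>
     (\<Sum>I\<in>m. scatter r s I) \<le> (\<Sum>(j',k')\<in>below N j k - K. haar_energy r N s j' k')"
  using assms
proof (induction "N - j" arbitrary: j k)
  case 0
  then have j: "j = N" by simp
  have "{dyad N j k} \<in> dyadic_parts N j k"
    using 0 dyad_in_dyadic_intervals partition_on_space[OF dyad_nonempty] by (auto simp: dyadic_parts_def)
  then show ?case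
    by (intro bexI[of _ "{dyad N j k}"]) (auto simp: j dyad_leaf below_leaf scatter_def)
next
  case (Suc d)
  then have j: "j < N" by simp
  show ?case
  proof (cases "below N j k \<inter> K = {}")
    case True
    have "{dyad N j k} \<in> dyadic_parts N j k"
      using Suc dyad_in_dyadic_intervals partition_on_space[OF dyad_nonempty] by (auto simp: dyadic_parts_def)
    moreover have "below N j k - K = below N j k" using True by auto
    ultimately show ?thesis
      using scatter_eq_sum_energy[OF Suc.prems, of r s]
      by (intro bexI[of _ "{dyad N j k}"]) auto
  next
    case False
    define L where "L = below N (Suc j) (2*k)"
    define Q where "Q = below N (Suc j) (2*k+1)"
    define cl where "cl S = {v \<in> S. below N (fst v) (snd v) \<inter> K \<noteq> {}}" for S
    have LQ: "below N j k = insert (j,k) (L \<union> Q)" "L \<inter> Q = {}" "(j,k) \<notin> L \<union> Q" "finite L" "finite Q"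
      using below_split[OF j, of k] finite_below by (auto simp: L_def Q_def)
    have idx: "d = N - Suc j" "Suc j \<le> N" "2*k < 2^Suc j" "2*k+1 < 2^Suc j"
      using Suc.hyps(2) Suc.prems by auto
    obtain m1 where m1: "m1 \<in> dyadic_parts N (Suc j) (2*k)" "card m1 \<le> 1 + card (cl L)"
        "(\<Sum>I\<in>m1. scatter r s I) \<le> (\<Sum>(j',k')\<in>L - K. haar_energy r N s j' k')"
      using Suc.hyps(1)[of "Suc j" "2*k"] idx unfolding L_def cl_def by blast
    obtain m2 where m2: "m2 \<in> dyadic_parts N (Suc j) (2*k+1)" "card m2 \<le> 1 + card (cl Q)"
        "(\<Sum>I\<in>m2. scatter r s I) \<le> (\<Sum>(j',k')\<in>Q - K. haar_energy r N s j' k')"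
      using Suc.hyps(1)[of "Suc j" "2*k+1"] idx unfolding Q_def cl_def by blast
    note mU = dyadic_parts_Un[OF j m1(1) m2(1)]
    have fin: "finite m1" "finite m2"
      using m1(1) m2(1) finite_elements[OF finite_dyad] by (auto simp: dyadic_parts_def)
    have cl: "cl (below N j k) = insert (j,k) (cl L \<union> cl Q)"
    proof -
      have "cl (insert (j,k) (L \<union> Q)) = insert (j,k) (cl L \<union> cl Q)" using False by (auto simp: cl_def)
      then show ?thesis by (simp only: LQ(1))
    qed
    have cc: "card (cl (below N j k)) = 1 + (card (cl L) + card (cl Q))"
    proof -
      have "finite (cl L)" "finite (cl Q)" "cl L \<inter> cl Q = {}" "(j,k) \<notin> cl L \<union> cl Q"
        using LQ by (auto simp: cl_def)
      then show ?thesis unfolding cl by (simp add: card_Un_disjoint)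
    qed
    have "card (m1 \<union> m2) \<le> 1 + card (cl (below N j k))"
      using m1(2) m2(2) fin mU(2) by (simp add: card_Un_disjoint cc)
    moreover have "(\<Sum>I\<in>m1 \<union> m2. scatter r s I) \<le> (\<Sum>(j',k')\<in>below N j k - K. haar_energy r N s j' k')"
    proof -
      have "(\<Sum>I\<in>m1 \<union> m2. scatter r s I) \<le> (\<Sum>(j',k')\<in>L - K. haar_energy r N s j' k') + (\<Sum>(j',k')\<in>Q - K. haar_energy r N s j' k')"
        using m1(3) m2(3) fin mU(2) by (simp add: sum.union_disjoint)
      also have "\<dots> = (\<Sum>(j',k')\<in>(L - K) \<union> (Q - K). haar_energy r N s j' k')"
        using LQ by (intro sum.union_disjoint[symmetric]) auto
      also have "\<dots> \<le> (\<Sum>(j',k')\<in>below N j k - K. haar_energy r N s j' k')"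
        using LQ haar_energy_nonneg by (intro sum_mono2) auto
      finally show ?thesis .
    qed
    ultimately show ?thesis using mU(1) unfolding cl_def by blast
  qed
qed

section \<open>Sparse approximation by thresholding\<close>

lemma sum_power_lt_geometric:
  fixes x :: real
  assumes "0 \<le> x" "x < 1"
  shows "(\<Sum>i<n. x ^ i) \<le> 1 / (1 - x)"
  using assms by (simp add: sum_gp_strict divide_right_mono)

text \<open>Partial sums of the differentiated geometric series; the closed form displays the
  remainder with its sign.\<close>

lemma sum_Suc_power_le:
  fixes x :: real
  assumes "0 \<le> x" "x < 1"
  shows "(\<Sum>i<n. real (i + 1) * x ^ i) \<le> 1 / (1 - x)\<^sup>2"
proof -
  have "(\<Sum>i<n. real (i + 1) * x ^ i) * (1 - x)\<^sup>2 = 1 - x ^ n * (1 + real n * (1 - x))"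
    by (induction n) (simp_all add: power2_eq_square algebra_simps)
  also have "\<dots> \<le> 1" using assms by simp
  finally show ?thesis using assms by (simp add: field_simps)
qed

text \<open>A single level is at most the whole sum, whose terms are non-negative; the rest moves
  the weight of the level to the other side.\<close>

lemma besov_level_bound:
  assumes p: "0 < p" and R: "0 \<le> R" and s: "s \<in> besov_body r N \<alpha> p R" and j: "j < N"
  shows "(\<Sum>k<2^j. L2_set (haar_coeff (2^N) s j k) {1..r} powr p)
    \<le> (sqrt (2^N) * R * 2 powr (- (real j * (\<alpha> + 1/2 - 1/p)))) powr p"
proof -
  define B where "B j = (\<Sum>k<2^j. L2_set (haar_coeff (2^N) s j k) {1..r} powr p)" for j
  define S where "S = (\<Sum>j<N. 2 powr (real j * p * (\<alpha> + 1/2 - 1/p)) * B j)"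
  have B0: "0 \<le> B j" for j unfolding B_def by (intro sum_nonneg) auto
  have S0: "0 \<le> S" unfolding S_def using B0 by (intro sum_nonneg) auto
  have "S powr (1/p) \<le> sqrt (2^N) * R" using s by (simp add: besov_body_def S_def B_def)
  then have "(S powr (1/p)) powr p \<le> (sqrt (2^N) * R) powr p" using p by (intro powr_mono2) auto
  then have S: "S \<le> (sqrt (2^N) * R) powr p" using p S0 by (simp add: powr_powr)
  define e where "e = real j * (\<alpha> + 1/2 - 1/p) * p"
  have e: "real j * p * (\<alpha> + 1/2 - 1/p) = e" by (simp add: e_def)
  have "2 powr (real j * p * (\<alpha> + 1/2 - 1/p)) * B j \<le> S"
    unfolding S_def using j B0 by (intro member_le_sum) auto
  then have "2 powr (- e) * (2 powr e * B j) \<le> 2 powr (- e) * (sqrt (2^N) * R) powr p"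
    unfolding e using S by (intro mult_left_mono) auto
  moreover have "2 powr (- e) * (2 powr e * B j) = B j"
    by (simp add: mult.assoc[symmetric] powr_add[symmetric])
  ultimately have "B j \<le> 2 powr (- (real j * (\<alpha> + 1/2 - 1/p)) * p) * (sqrt (2^N) * R) powr p"
    by (simp only: e_def minus_mult_left)
  also have "\<dots> = (sqrt (2^N) * R * 2 powr (- (real j * (\<alpha> + 1/2 - 1/p)))) powr p"
    using R by (simp add: powr_mult powr_powr)
  finally show ?thesis unfolding B_def .
qed

text \<open>Markov's inequality for p-th powers: the threshold is calibrated so that its p-th power
  is c^p / M.\<close>

lemma card_above_threshold:
  fixes b :: "'a \<Rightarrow> real"
  assumes "finite A" "0 < p" "0 < c" "0 < M" "(\<Sum>k\<in>A. b k powr p) \<le> c powr p"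
  shows "real (card {k \<in> A. c * M powr (-1/p) < b k}) \<le> M"
proof -
  let ?H = "{k \<in> A. c * M powr (-1/p) < b k}"
  have "real (card ?H) * (c powr p / M) = (\<Sum>k\<in>?H. (c * M powr (-1/p)) powr p)"
  proof -
    have "(c * M powr (-1/p)) powr p = c powr p * (M powr (-1/p)) powr p" using assms(3) by (simp add: powr_mult)
    also have "(M powr (-1/p)) powr p = M powr (-1)" using assms(2) unfolding powr_powr by simp
    also have "M powr (-1) = 1 / M" using assms(4) by (simp add: powr_minus_divide)
    finally show ?thesis by simp
  qed
  also have "\<dots> \<le> (\<Sum>k\<in>?H. b k powr p)"
    using assms(2-4) by (intro sum_mono powr_mono2) auto
  also have "\<dots> \<le> (\<Sum>k\<in>A. b k powr p)" using assms(1) by (intro sum_mono2) auto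
  also have "\<dots> \<le> c powr p" by fact
  finally show ?thesis using assms(3,4) by (simp add: field_simps)
qed

text \<open>Interpolation: a square is b^p b^(2-p), and for p \<le> 2 the second factor is at most
  the threshold to the power 2 - p.\<close>

lemma sum_square_below_threshold:
  fixes b :: "'a \<Rightarrow> real"
  assumes "finite A" "0 < p" "p \<le> 2" "0 < c" "0 < M" "\<And>k. k \<in> A \<Longrightarrow> 0 \<le> b k" "(\<Sum>k\<in>A. b k powr p) \<le> c powr p"
  shows "(\<Sum>k\<in>{k \<in> A. b k \<le> c * M powr (-1/p)}. (b k)\<^sup>2) \<le> c\<^sup>2 * M powr (1 - 2/p)"
proof -
  let ?\<tau> = "c * M powr (-1/p)"
  let ?L = "{k \<in> A. b k \<le> ?\<tau>}"
  have "(\<Sum>k\<in>?L. (b k)\<^sup>2) \<le> (\<Sum>k\<in>?L. b k powr p * ?\<tau> powr (2 - p))"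
  proof (rule sum_mono)
    fix k assume k: "k \<in> ?L"
    then have b: "0 \<le> b k" "b k \<le> ?\<tau>" using assms(6) by auto
    have "(b k)\<^sup>2 = b k powr p * b k powr (2 - p)"
    proof (cases "b k = 0")
      case False
      then have "b k powr p * b k powr (2 - p) = b k powr 2" by (simp flip: powr_add)
      then show ?thesis using b False by (simp add: powr_numeral)
    qed (use assms in simp)
    also have "\<dots> \<le> b k powr p * ?\<tau> powr (2 - p)"
      using b assms(3) by (intro mult_left_mono powr_mono2) auto
    finally show "(b k)\<^sup>2 \<le> b k powr p * ?\<tau> powr (2 - p)" .
  qed
  also have "\<dots> = (\<Sum>k\<in>?L. b k powr p) * ?\<tau> powr (2 - p)" by (simp add: sum_distrib_right)
  also have "\<dots> \<le> c powr p * ?\<tau> powr (2 - p)"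
  proof (rule mult_right_mono)
    have "(\<Sum>k\<in>?L. b k powr p) \<le> (\<Sum>k\<in>A. b k powr p)" using assms(1) by (intro sum_mono2) auto
    then show "(\<Sum>k\<in>?L. b k powr p) \<le> c powr p" using assms(7) by linarith
  qed simp
  also have "\<dots> = (c powr p * c powr (2 - p)) * M powr ((-1/p) * (2 - p))"
    using assms(4,5) by (simp add: powr_mult powr_powr)
  also have "c powr p * c powr (2 - p) = c\<^sup>2" using assms(4) by (simp add: powr_numeral flip: powr_add)
  also have "(-1/p) * (2 - p) = 1 - 2/p" using assms(2) by (simp add: field_simps)
  finally show ?thesis .
qed

lemma besov_dyadic_approximation:
  fixes p \<alpha> :: real
  assumes p: "0 < p" "p \<le> 2" and \<alpha>: "\<alpha> > 1/p - 1/2"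
  obtains C1 C2 :: real where "0 < C1" "0 < C2"
    "\<And>r N J R s. 0 < R \<Longrightarrow> J \<le> N \<Longrightarrow> s \<in> besov_body r N \<alpha> p R \<Longrightarrow>
      \<exists>m\<in>dyadic_partitions N. real (card m) \<le> C1 * 2^J \<and>
        (\<Sum>I\<in>m. scatter r s I) \<le> C2 * (2^N * R\<^sup>2 * 2 powr (- 2 * \<alpha> * real J))"
proof -
  define \<sigma> where "\<sigma> = \<alpha> + 1/2 - 1/p"
  define \<delta> where "\<delta> = \<sigma> * p / 2"
  have \<sigma>: "0 < \<sigma>" using \<alpha> by (simp add: \<sigma>_def)
  have \<delta>: "0 < \<delta>" using \<sigma> p by (simp add: \<delta>_def)
  define u where "u = 2 powr (- \<delta>)"
  define w where "w = 2 powr (- \<sigma>)"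
  have u: "0 \<le> u" "u < 1" and w: "0 \<le> w" "w < 1"
    using \<sigma> \<delta> by (auto simp: u_def w_def powr_minus_divide)
  have upow: "u ^ i = 2 powr (- \<delta> * real i)" and wpow: "w ^ i = 2 powr (- \<sigma> * real i)" for i
    by (simp_all add: u_def w_def powr_powr flip: powr_realpow)
  \<comment> \<open>One unit absorbs the additive 1 of the tree count, one counts the nodes above
    level \<open>J\<close>, and the last term counts kept coefficients of finer levels with their
    ancestors.\<close>
  define C1 where "C1 = 2 + 1 / (1 - u)\<^sup>2"
  define C2 where "C2 = 1 / (1 - w)"
  show ?thesis
  proof (rule that)
    show "0 < C1" "0 < C2" using u w by (auto simp: C1_def C2_def add_pos_nonneg)
  next
    fix r N J :: nat and R :: real and s :: rmat
    assume R: "0 < R" and J: "J \<le> N" and s: "s \<in> besov_body r N \<alpha> p R"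
    define \<rho> where "\<rho> = sqrt (2^N) * R"
    have \<rho>: "0 < \<rho>" using R by (simp add: \<rho>_def)
    define b where "b j k = L2_set (haar_coeff (2^N) s j k) {1..r}" for j k
    define c where "c j = \<rho> * 2 powr (- (real j * \<sigma>))" for j
    define M where "M j = 2^J * u ^ (j - J)" for j
    have b0: "0 \<le> b j k" for j k by (simp add: b_def)
    have b2: "haar_energy r N s j k = (b j k)\<^sup>2" for j k
      by (simp add: b_def haar_energy_def L2_set_def sum_nonneg)
    have c0: "0 < c j" for j using \<rho> by (simp add: c_def)
    have M0: "0 < M j" for j by (simp add: M_def u_def)
    have level: "(\<Sum>k<2^j. b j k powr p) \<le> c j powr p" if "j < N" for j
      using besov_level_bound[OF p(1) _ s that] R by (simp add: b_def c_def \<rho>_def \<sigma>_def)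
    \<comment> \<open>At level \<open>j\<close> at most \<open>M j\<close> coefficients are kept: few enough for the ancestors
      (\<open>j - J + 1\<close> of them at levels \<open>J, \<dots>, j\<close>) to be summable, many enough for the \<open>\<ell>\<^sub>p\<close> tails to be summable since
      \<open>\<delta> = \<sigma> p / 2\<close>.\<close>
    define big where "big j = {k \<in> {..<2^j}. c j * M j powr (-1/p) < b j k}" for j :: nat
    define K where "K = {(j,k). j < J \<or> k \<in> big j}"
    obtain m where m: "m \<in> dyadic_parts N 0 0"
      "card m \<le> 1 + card {v \<in> below N 0 0. below N (fst v) (snd v) \<inter> K \<noteq> {}}"
      "(\<Sum>I\<in>m. scatter r s I) \<le> (\<Sum>(j',k')\<in>below N 0 0 - K. haar_energy r N s j' k')"
      using tree_partition_exists[of 0 N 0 K r s] by auto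
    have below0: "(j,k) \<in> below N 0 0 \<longleftrightarrow> j < N \<and> k < 2^j" for j k
      by (auto simp: below_def div_eq_0_iff)
    have "real (card m) \<le> C1 * 2^J"
    proof -
      \<comment> \<open>\<open>A\<close> holds the coarse nodes, all of which may be split, and
        \<open>B\<close> the ancestors at level \<open>J\<close> or finer of large
        coefficients.\<close>
      define A where "A = (SIGMA j:{..<J}. {..<(2::nat)^j})"
      define anc where "anc j k = (\<lambda>i. (i, k div 2^(j-i))) ` {J..j}" for j k :: nat
      define B where "B = (\<Union>j\<in>{J..<N}. \<Union>k\<in>big j. anc j k)"
      have finbig: "finite (big j)" for j by (simp add: big_def)
      have "{v \<in> below N 0 0. below N (fst v) (snd v) \<inter> K \<noteq> {}} \<subseteq> A \<union> B"
      proof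
        fix v assume "v \<in> {v \<in> below N 0 0. below N (fst v) (snd v) \<inter> K \<noteq> {}}"
        then obtain i l j k where v: "v = (i,l)" "i < N" "l < 2^i" "(j,k) \<in> below N i l" "(j,k) \<in> K"
          using below0 by (cases v) auto
        show "v \<in> A \<union> B"
        proof (cases "i < J")
          case True
          then show ?thesis using v by (simp add: A_def)
        next
          case False
          have jk: "i \<le> j" "j < N" "k div 2^(j-i) = l" using v(4) by (auto simp: below_def)
          then have "k \<in> big j" using v(5) False by (auto simp: K_def)
          moreover have "v \<in> anc j k"
            unfolding anc_def v(1) using jk False by (intro image_eqI[of _ _ i]) auto
          ultimately show ?thesis using jk False unfolding B_def by force
        qed
      qed
      then have "card {v \<in> below N 0 0. below N (fst v) (snd v) \<inter> K \<noteq> {}} \<le> card (A \<union> B)"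
        by (intro card_mono) (auto simp: A_def B_def anc_def finbig)
      also have "\<dots> \<le> card A + card B" by (rule card_Un_le)
      also have "card A \<le> 2^J"
      proof -
        have "card A = (\<Sum>j<J. 2^j)" by (simp add: A_def)
        also have "\<dots> \<le> 2^J" by (induction J) auto
        finally show ?thesis .
      qed
      also have "card B \<le> (\<Sum>j=J..<N. card (big j) * (j - J + 1))"
        unfolding B_def
      proof (rule order_trans[OF card_UN_le], simp, rule sum_mono)
        fix j assume j: "j \<in> {J..<N}"
        have "card (\<Union>k\<in>big j. anc j k) \<le> (\<Sum>k\<in>big j. card (anc j k))"
          by (rule card_UN_le[OF finbig])
        also have "\<dots> \<le> (\<Sum>k\<in>big j. j - J + 1)"
        proof (rule sum_mono)
          fix k
          have "card (anc j k) \<le> card {J..j}" unfolding anc_def by (rule card_image_le) simp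
          then show "card (anc j k) \<le> j - J + 1" using j by (simp add: Suc_diff_le)
        qed
        finally show "card (\<Union>k\<in>big j. anc j k) \<le> card (big j) * (j - J + 1)" by simp
      qed
      finally have "card m \<le> 1 + (2^J + (\<Sum>j=J..<N. card (big j) * (j - J + 1)))"
        using m(2) by linarith
      then have "real (card m) \<le> real (1 + (2^J + (\<Sum>j=J..<N. card (big j) * (j - J + 1))))"
        by (rule of_nat_mono)
      also have "\<dots> = 1 + (2^J + (\<Sum>j=J..<N. real (card (big j)) * real (j - J + 1)))"
        by (simp add: distrib_left)
      also have "(\<Sum>j=J..<N. real (card (big j)) * real (j - J + 1)) \<le> (\<Sum>j=J..<N. M j * real (j - J + 1))"
      proof (intro sum_mono mult_right_mono)
        fix j assume "j \<in> {J..<N}"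
        then show "real (card (big j)) \<le> M j"
          unfolding big_def using p(1) c0 M0 b0 level by (intro card_above_threshold) auto
      qed simp
      also have "\<dots> = 2^J * (\<Sum>i<N-J. real (i + 1) * u ^ i)"
        by (simp add: sum.atLeastLessThan_shift_0[of _ J N] M_def sum_distrib_left lessThan_atLeast0 mult_ac)
      also have "\<dots> \<le> 2^J * (1 / (1 - u)\<^sup>2)"
        using sum_Suc_power_le[OF u] by (intro mult_left_mono) auto
      also have "1 + (2^J + 2^J * (1 / (1 - u)\<^sup>2)) \<le> C1 * 2^J"
        by (simp add: C1_def algebra_simps)
      finally show ?thesis by simp
    qed
    moreover have "(\<Sum>I\<in>m. scatter r s I) \<le> C2 * (2^N * R\<^sup>2 * 2 powr (- 2 * \<alpha> * real J))"
    proof -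
      have eq: "below N 0 0 - K = (SIGMA j:{J..<N}. {k \<in> {..<2^j}. b j k \<le> c j * M j powr (-1/p)})"
        using below0 by (auto simp: K_def big_def not_less)
      have "(\<Sum>(j',k')\<in>below N 0 0 - K. haar_energy r N s j' k')
        = (\<Sum>j=J..<N. \<Sum>k\<in>{k \<in> {..<2^j}. b j k \<le> c j * M j powr (-1/p)}. (b j k)\<^sup>2)"
        unfolding eq b2 by (rule sum.Sigma[symmetric]) auto
      also have "\<dots> \<le> (\<Sum>j=J..<N. (c j)\<^sup>2 * M j powr (1 - 2/p))"
        using p c0 M0 b0 level by (intro sum_mono sum_square_below_threshold) auto
      also have "\<dots> \<le> (\<Sum>j=J..<N. \<rho>\<^sup>2 * 2 powr (- 2 * \<alpha> * real J) * w ^ (j - J))"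
      proof (rule sum_mono)
        fix j assume j: "j \<in> {J..<N}"
        define i where "i = j - J"
        have ji: "real j = real J + real i" using j by (simp add: i_def)
        have c2: "(c j)\<^sup>2 = \<rho>\<^sup>2 * 2 powr (- 2 * \<sigma> * real j)"
          by (simp add: c_def power_mult_distrib power2_eq_square mult_ac flip: powr_add)
        have Mj: "M j = 2 powr (real J - \<delta> * real i)"
          by (simp add: M_def upow i_def powr_diff powr_minus powr_realpow divide_inverse)
        have "(c j)\<^sup>2 * M j powr (1 - 2/p) = \<rho>\<^sup>2 * 2 powr (- 2 * \<sigma> * real j + (real J - \<delta> * real i) * (1 - 2/p))"
          unfolding c2 Mj powr_powr by (simp only: powr_add mult.assoc)
        \<comment> \<open>The coefficient of \<open>J\<close> is -2\<sigma> + 1 - 2/p = -2\<alpha>.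
          Since 2\<delta>/p = \<sigma>, the growth from the shrinking \<open>M j\<close> uses up
          only half of the decay 2\<sigma> per level; the spare \<open>\<delta>\<close> is then
          dropped.\<close>
        also have "- 2 * \<sigma> * real j + (real J - \<delta> * real i) * (1 - 2/p)
          = - 2 * \<alpha> * real J + (- \<sigma> * real i - \<delta> * real i)"
          unfolding ji \<delta>_def \<sigma>_def using p by (simp add: field_simps)
        also have "2 powr (- 2 * \<alpha> * real J + (- \<sigma> * real i - \<delta> * real i)) \<le> 2 powr (- 2 * \<alpha> * real J + - \<sigma> * real i)"
          using \<delta> by (intro powr_mono) auto
        also have "\<rho>\<^sup>2 * 2 powr (- 2 * \<alpha> * real J + - \<sigma> * real i) = \<rho>\<^sup>2 * 2 powr (- 2 * \<alpha> * real J) * w ^ (j - J)"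
          unfolding wpow i_def[symmetric] by (simp only: powr_add mult.assoc)
        finally show "(c j)\<^sup>2 * M j powr (1 - 2/p) \<le> \<rho>\<^sup>2 * 2 powr (- 2 * \<alpha> * real J) * w ^ (j - J)"
          using \<rho> by simp
      qed
      also have "\<dots> = \<rho>\<^sup>2 * 2 powr (- 2 * \<alpha> * real J) * (\<Sum>i<N-J. w ^ i)"
        by (simp add: sum.atLeastLessThan_shift_0[of _ J N] sum_distrib_left lessThan_atLeast0)
      also have "\<dots> \<le> \<rho>\<^sup>2 * 2 powr (- 2 * \<alpha> * real J) * C2"
        unfolding C2_def using sum_power_lt_geometric[OF w] by (intro mult_left_mono) auto
      also have "\<dots> = C2 * (2^N * R\<^sup>2 * 2 powr (- 2 * \<alpha> * real J))"
        by (simp add: \<rho>_def power_mult_distrib)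
      finally show ?thesis using m(3) by linarith
    qed
    ultimately show "\<exists>m\<in>dyadic_partitions N. real (card m) \<le> C1 * 2^J \<and>
        (\<Sum>I\<in>m. scatter r s I) \<le> C2 * (2^N * R\<^sup>2 * 2 powr (- 2 * \<alpha> * real J))"
      using m(1) unfolding dyadic_partitions_eq by blast
  qed
qed

section \<open>Lower bound\<close>

text \<open>Le Cam's inequality between Hellinger affinity and overlap: write pq as min times max,
  apply Cauchy-Schwarz, and bound the mass of the maximum by 2.\<close>

lemma sum_sqrt_mult_le_sum_min:
  fixes p q :: "'a \<Rightarrow> real"
  assumes "finite A" "\<And>y. y \<in> A \<Longrightarrow> 0 \<le> p y" "\<And>y. y \<in> A \<Longrightarrow> 0 \<le> q y"
    "(\<Sum>y\<in>A. p y) = 1" "(\<Sum>y\<in>A. q y) = 1"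
  shows "(\<Sum>y\<in>A. sqrt (p y * q y))\<^sup>2 \<le> 2 * (\<Sum>y\<in>A. min (p y) (q y))"
proof -
  have "p y * q y = min (p y) (q y) * max (p y) (q y)" for y
    by (simp add: min_def max_def)
  then have "(\<Sum>y\<in>A. sqrt (p y * q y))\<^sup>2 = (\<Sum>y\<in>A. sqrt (min (p y) (q y)) * sqrt (max (p y) (q y)))\<^sup>2"
    by (simp add: real_sqrt_mult)
  also have "\<dots> \<le> (\<Sum>y\<in>A. (sqrt (min (p y) (q y)))\<^sup>2) * (\<Sum>y\<in>A. (sqrt (max (p y) (q y)))\<^sup>2)"
    by (rule Cauchy_Schwarz_ineq_sum)
  also have "\<dots> = (\<Sum>y\<in>A. min (p y) (q y)) * (\<Sum>y\<in>A. max (p y) (q y))"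
    using assms(2,3) by (intro arg_cong2[where f = "(*)"] sum.cong refl real_sqrt_pow2) (auto simp: le_max_iff_disj)
  also have "\<dots> \<le> (\<Sum>y\<in>A. min (p y) (q y)) * 2"
  proof (rule mult_left_mono)
    have "(\<Sum>y\<in>A. max (p y) (q y)) \<le> (\<Sum>y\<in>A. p y + q y)"
      using assms(2,3) by (intro sum_mono) (auto simp: max_def)
    then show "(\<Sum>y\<in>A. max (p y) (q y)) \<le> 2" using assms(4,5) by (simp add: sum.distrib)
    show "0 \<le> (\<Sum>y\<in>A. min (p y) (q y))" using assms(2,3) by (intro sum_nonneg) auto
  qed
  finally show ?thesis by simp
qed

lemma sqrt_prod: "sqrt (\<Prod>i\<in>A. f i) = (\<Prod>i\<in>A. sqrt (f i))"
  by (induction A rule: infinite_finite_induct) (simp_all add: real_sqrt_mult)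

text \<open>The affinity of two product laws factorizes over the columns, by expanding the product
  of sums.\<close>

lemma min_likelihood_ge_affinity:
  assumes s: "s \<in> prob_mats r n" and s': "s' \<in> prob_mats r n"
  shows "(\<Prod>i=1..n. \<Sum>l=1..r. sqrt (s l i * s' l i))\<^sup>2
    \<le> 2 * (\<Sum>y\<in>PiE {1..n} (\<lambda>_. {1..r}). min (\<Prod>i=1..n. s (y i) i) (\<Prod>i=1..n. s' (y i) i))"
proof -
  have one: "(\<Sum>y\<in>PiE {1..n} (\<lambda>_. {1..r}). \<Prod>i=1..n. t (y i) i) = 1" if "t \<in> prob_mats r n" for t
    using prod_expect_const[of "{1..n}" t r 1] that by (auto simp: prod_expect_def prob_mats_def)
  have nonneg: "0 \<le> (\<Prod>i=1..n. t (y i) i)" if "t \<in> prob_mats r n" "y \<in> PiE {1..n} (\<lambda>_. {1..r})" for t y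
  proof (rule prod_nonneg)
    fix i assume i: "i \<in> {1..n}"
    show "0 \<le> t (y i) i" using that(1) PiE_mem[OF that(2) i] i by (auto simp: prob_mats_def)
  qed
  have "(\<Prod>i=1..n. \<Sum>l=1..r. sqrt (s l i * s' l i))
     = (\<Sum>y\<in>PiE {1..n} (\<lambda>_. {1..r}). \<Prod>i=1..n. sqrt (s (y i) i * s' (y i) i))"
    by (rule prod_sum_PiE) auto
  also have "\<dots> = (\<Sum>y\<in>PiE {1..n} (\<lambda>_. {1..r}). sqrt ((\<Prod>i=1..n. s (y i) i) * (\<Prod>i=1..n. s' (y i) i)))"
    by (simp add: real_sqrt_mult sqrt_prod prod.distrib)
  finally show ?thesis
    using sum_sqrt_mult_le_sum_min[of "PiE {1..n} (\<lambda>_. {1..r})" "\<lambda>y. \<Prod>i=1..n. s (y i) i" "\<lambda>y. \<Prod>i=1..n. s' (y i) i"]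
      nonneg[OF s] nonneg[OF s'] one[OF s] one[OF s'] finite_PiE[of "{1..n}" "\<lambda>_. {1..r}"] by simp
qed

text \<open>Pairs each sign pattern with the one obtained by flipping coordinate
  \<open>k\<close>.\<close>

lemma sum_Pow_split:
  fixes f :: "'a set \<Rightarrow> real"
  assumes "finite A" "k \<in> A"
  shows "(\<Sum>T\<in>Pow A. f T) = (\<Sum>T\<in>Pow (A - {k}). f T + f (insert k T))"
proof -
  have "inj_on (insert k) (Pow (A - {k}))"
    by (rule inj_onI) blast
  moreover have "Pow A = Pow (A - {k}) \<union> insert k ` Pow (A - {k})"
    using Pow_insert[of k "A - {k}"] assms(2) by (simp add: insert_absorb)
  moreover have "Pow (A - {k}) \<inter> insert k ` Pow (A - {k}) = {}" by auto
  ultimately show ?thesis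
    using assms(1) by (simp add: sum.union_disjoint sum.reindex sum.distrib)
qed

text \<open>The amplitude satisfies 8 \<delta>^2 L = 1 for the block length L =
  \<open>2^(N-J)\<close>: small enough that one flip is hard to detect, large enough that it costs a
  constant squared loss.\<close>

locale sign_family =
  fixes N J r :: nat and \<delta> :: real
  assumes JN: "J < N" and r2: "2 \<le> r" and \<delta>_def: "\<delta> = 1 / sqrt (8 * 2^(N-J))"
begin

text \<open>\<open>T\<close> lists the blocks of level \<open>J\<close> carrying a plus sign. The
  second factor is the Haar shape, positive on the first half of a block and negative on the
  second.\<close>

definition sgn_pattern :: "nat set \<Rightarrow> nat \<Rightarrow> real" where
  "sgn_pattern T i = (if (i - 1) div 2^(N-J) \<in> T then \<delta> else - \<delta>) * (if even ((i - 1) div 2^(N - Suc J)) then 1 else - 1)"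

definition sgn_mat :: "nat set \<Rightarrow> rmat" where
  "sgn_mat T l i = (if i \<in> {1..2^N} then of_bool (l = 1) * (1/2 + sgn_pattern T i) + of_bool (l = 2) * (1/2 - sgn_pattern T i) else 0)"

lemma \<delta>_pos: "0 < \<delta>" by (simp add: \<delta>_def)

lemma \<delta>_square: "\<delta>\<^sup>2 = 1 / (8 * 2^(N-J))"
  by (simp add: \<delta>_def power_divide)

lemma \<delta>_le_half: "\<delta> \<le> 1/2"
proof -
  have "(1::real) \<le> 2^(N-J)" by simp
  then have "(1::real) \<le> 2 * 2^(N-J)" by linarith
  then have "\<delta>\<^sup>2 \<le> (1/2)\<^sup>2" unfolding \<delta>_square by (simp add: field_simps power2_eq_square)
  then show ?thesis by (rule power2_le_imp_le) simp
qed

lemma sgn_pattern_square: "(sgn_pattern T i)\<^sup>2 = \<delta>\<^sup>2"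
  by (simp add: sgn_pattern_def power_mult_distrib)

lemma sgn_pattern_bound: "\<bar>sgn_pattern T i\<bar> \<le> 1/2"
  using \<delta>_le_half \<delta>_pos by (simp add: sgn_pattern_def abs_mult)

lemma sum_first_two:
  fixes f :: "nat \<Rightarrow> real"
  assumes "\<And>l. 2 < l \<Longrightarrow> f l = 0"
  shows "(\<Sum>l=1..r. f l) = f 1 + f 2"
proof -
  have "(\<Sum>l=1..r. f l) = (\<Sum>l\<in>{1,2}. f l)"
    using r2 assms by (intro sum.mono_neutral_right) (auto simp: not_le less_Suc_eq numeral_2_eq_2)
  then show ?thesis by simp
qed

lemma sgn_mat_in_prob_mats: "sgn_mat T \<in> prob_mats r (2^N)"
proof -
  have b: "0 \<le> 1/2 + sgn_pattern T i" "0 \<le> 1/2 - sgn_pattern T i" for i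
    using sgn_pattern_bound[of T i] by linarith+
  have "(\<Sum>l=1..r. sgn_mat T l i) = 1" if "i \<in> {1..2^N}" for i
    using that by (subst sum_first_two) (auto simp: sgn_mat_def)
  moreover have "0 \<le> sgn_mat T l i" for l i using b by (simp add: sgn_mat_def)
  moreover have "sgn_mat T \<in> Mat r (2^N)"
    using r2 by (auto simp: Mat_def sgn_mat_def split: if_splits)
  ultimately show ?thesis by (simp add: prob_mats_def)
qed

lemma sgn_pattern_on_half:
  "i \<in> dyad N (Suc J) (2*k) \<Longrightarrow> sgn_pattern T i = (if k \<in> T then \<delta> else - \<delta>)"
  "i \<in> dyad N (Suc J) (2*k+1) \<Longrightarrow> sgn_pattern T i = - (if k \<in> T then \<delta> else - \<delta>)"
proof -
  have e: "(2::nat)^(N-J) = 2^(N-Suc J) * 2" using JN by (simp flip: power_Suc2 add: Suc_diff_Suc)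
  show "i \<in> dyad N (Suc J) (2*k) \<Longrightarrow> sgn_pattern T i = (if k \<in> T then \<delta> else - \<delta>)"
    "i \<in> dyad N (Suc J) (2*k+1) \<Longrightarrow> sgn_pattern T i = - (if k \<in> T then \<delta> else - \<delta>)"
    unfolding mem_dyad sgn_pattern_def e div_mult2_eq by auto
qed

text \<open>The two halves of a block of level \<open>J\<close> cancel, and coarser intervals are
  unions of such blocks.\<close>

lemma sum_sgn_pattern_coarse:
  assumes "j \<le> J"
  shows "(\<Sum>i\<in>dyad N j k. sgn_pattern T i) = 0"
  using assms
proof (induction "J - j" arbitrary: j k)
  case 0
  then have j: "j = J" by simp
  show ?case unfolding j dyad_split(1)[OF JN]
    using dyad_split(2)[OF JN] by (simp add: sum.union_disjoint finite_dyad sgn_pattern_on_half card_dyad)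
next
  case (Suc d)
  then have j: "j < N" using JN by simp
  have "d = J - Suc j" "Suc j \<le> J" using Suc by auto
  then have "(\<Sum>i\<in>dyad N (Suc j) k'. sgn_pattern T i) = 0" for k' by (rule Suc.hyps)
  then show ?case unfolding dyad_split(1)[OF j]
    using dyad_split(2)[OF j] by (simp add: sum.union_disjoint finite_dyad)
qed

definition half_diff :: "nat set \<Rightarrow> nat \<Rightarrow> nat \<Rightarrow> real" where
  "half_diff T j k = (\<Sum>i\<in>dyad N (Suc j) (2*k). sgn_pattern T i) - (\<Sum>i\<in>dyad N (Suc j) (2*k+1). sgn_pattern T i)"

text \<open>On coarser levels each half sums to zero. On finer levels the interval lies inside one
  half block, where the pattern is constant, so the two halves agree.\<close>

lemma half_diff_off_level:
  assumes "j < N" "j \<noteq> J"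
  shows "half_diff T j k = 0"
proof (cases "j < J")
  case True
  then show ?thesis by (simp add: half_diff_def sum_sgn_pattern_coarse)
next
  case False
  then have j: "Suc J \<le> j" using assms by simp
  define k' where "k' = k div 2^(j - Suc J)"
  define c where "c = (if even k' then 1 else - 1) * (if k' div 2 \<in> T then \<delta> else - \<delta>)"
  have c: "sgn_pattern T i = c" if "i \<in> dyad N j k" for i
  proof -
    have "i \<in> dyad N (Suc J) k'"
      using dyad_subset_ancestor[OF j, of N k] assms that by (auto simp: k'_def)
    then show ?thesis
      using sgn_pattern_on_half[of i "k' div 2" T] unfolding c_def
      by (cases "even k'") (simp_all add: odd_two_times_div_two_succ)
  qed
  have "sgn_pattern T i = c" if "i \<in> dyad N (Suc j) (2*k) \<or> i \<in> dyad N (Suc j) (2*k+1)" for i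
    using that dyad_split(1)[OF assms(1), of k] by (intro c) auto
  then show ?thesis by (simp add: half_diff_def card_dyad)
qed

lemma half_diff_square: "(half_diff T J k)\<^sup>2 = (2^(N-J))\<^sup>2 * \<delta>\<^sup>2"
proof -
  have "half_diff T J k = 2 * 2^(N - Suc J) * (if k \<in> T then \<delta> else - \<delta>)"
    by (simp add: half_diff_def sgn_pattern_on_half card_dyad)
  also have "(2::real) * 2^(N - Suc J) = 2^(N-J)"
    using JN by (simp flip: power_Suc add: Suc_diff_Suc)
  finally show ?thesis by (simp add: power_mult_distrib)
qed

lemma haar_coeff_sgn_mat:
  assumes "j < N" "k < 2^j"
  shows "haar_coeff (2^N) (sgn_mat T) j k l
    = 2 powr (real j / 2) / sqrt (2^N) * ((of_bool (l = 1) - of_bool (l = 2)) * half_diff T j k)"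
proof -
  have row: "(\<Sum>i\<in>A. sgn_mat T l i) = real (card A) * (of_bool (l = 1) + of_bool (l = 2)) / 2
      + (of_bool (l = 1) - of_bool (l = 2)) * (\<Sum>i\<in>A. sgn_pattern T i)" if "A \<subseteq> {1..2^N}" for A
  proof -
    have "(\<Sum>i\<in>A. sgn_mat T l i) = (\<Sum>i\<in>A. (of_bool (l = 1) + of_bool (l = 2)) / 2 + (of_bool (l = 1) - of_bool (l = 2)) * sgn_pattern T i)"
      using that by (intro sum.cong) (auto simp: sgn_mat_def)
    then show ?thesis by (simp add: sum.distrib sum_distrib_left)
  qed
  have sub: "dyad N (Suc j) (2*k) \<subseteq> {1..2^N}" "dyad N (Suc j) (2*k+1) \<subseteq> {1..2^N}"
    using assms by (intro dyad_subset_root; simp)+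
  show ?thesis
    unfolding haar_coeff_eq[OF assms] row[OF sub(1)] row[OF sub(2)] half_diff_def
    by (simp add: card_dyad right_diff_distrib)
qed

text \<open>Two rows contribute equally, and 2 \<delta>^2 L = 1/4 by the choice of the
  amplitude.\<close>

lemma L2_haar_coeff_sgn_mat:
  assumes "j < N" "k < 2^j"
  shows "L2_set (haar_coeff (2^N) (sgn_mat T) j k) {1..r} = (if j = J then 1/2 else 0)"
proof (cases "j = J")
  case True
  define C where "C = 2 powr (real J / 2) / sqrt (2^N)"
  have C2: "C\<^sup>2 = 1 / 2^(N-J)"
  proof -
    have "(2 powr (real J / 2))\<^sup>2 = (2::real)^J"
      by (simp add: power2_eq_square powr_realpow flip: powr_add)
    moreover have "(2::real)^N = 2^J * 2^(N-J)" using JN by (simp flip: power_add)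
    ultimately show ?thesis by (simp add: C_def power_divide)
  qed
  have "(\<Sum>l=1..r. (haar_coeff (2^N) (sgn_mat T) j k l)\<^sup>2) = 2 * (C\<^sup>2 * (half_diff T J k)\<^sup>2)"
    unfolding True haar_coeff_sgn_mat[OF JN assms(2)[unfolded True]] C_def[symmetric]
    by (subst sum_first_two) (auto simp: power_mult_distrib)
  also have "\<dots> = (1/2)\<^sup>2"
    unfolding C2 half_diff_square \<delta>_square by (simp add: power2_eq_square)
  finally have "L2_set (haar_coeff (2^N) (sgn_mat T) j k) {1..r} = sqrt ((1/2)\<^sup>2)"
    unfolding L2_set_def by (rule arg_cong)
  then show ?thesis using True by (simp only: real_sqrt_abs) simp
next
  case False
  then show ?thesis
    using haar_coeff_sgn_mat[OF assms] half_diff_off_level[OF assms(1)] by (simp add: L2_set_def)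
qed

text \<open>Only level \<open>J\<close> contributes, with \<open>2^J\<close> equal coefficients;
  their number cancels the -1/p in the exponent, leaving half of 2^(J(\<alpha> + 1/2)).\<close>

lemma sgn_mat_in_besov_body:
  assumes p: "0 < p" and R: "2 powr (real J * (\<alpha> + 1/2)) \<le> sqrt (2^N) * R"
  shows "sgn_mat T \<in> besov_body r N \<alpha> p R"
proof -
  have level: "(\<Sum>k<2^j. L2_set (haar_coeff (2^N) (sgn_mat T) j k) {1..r} powr p) = (if j = J then 2^J * (1/2) powr p else 0)"
    if "j < N" for j
  proof -
    have "(\<Sum>k<2^j. L2_set (haar_coeff (2^N) (sgn_mat T) j k) {1..r} powr p) = (\<Sum>k<(2::nat)^j. (if j = J then 1/2 else 0) powr p)"
      using that by (intro sum.cong refl arg_cong[where f = "\<lambda>x. x powr p"] L2_haar_coeff_sgn_mat) auto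
    then show ?thesis using p by simp
  qed
  have "(\<Sum>j<N. 2 powr (real j * p * (\<alpha> + 1/2 - 1/p)) *
            (\<Sum>k<2^j. L2_set (haar_coeff (2^N) (sgn_mat T) j k) {1..r} powr p))
      = (\<Sum>j<N. if j = J then 2 powr (real J * p * (\<alpha> + 1/2 - 1/p)) * (2^J * (1/2) powr p) else 0)"
    using level by (intro sum.cong refl) simp
  also have "\<dots> = 2 powr (real J * p * (\<alpha> + 1/2 - 1/p)) * (2 powr real J * (1/2) powr p)"
    using JN by (simp add: powr_realpow)
  also have "\<dots> = (2 powr (real J * (\<alpha> + 1/2)) * (1/2)) powr p"
  proof -
    have "real J * p * (\<alpha> + 1/2 - 1/p) + real J = real J * (\<alpha> + 1/2) * p"
      using p by (simp add: field_simps)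
    then have "2 powr (real J * p * (\<alpha> + 1/2 - 1/p)) * 2 powr real J = 2 powr (real J * (\<alpha> + 1/2) * p)"
      by (simp flip: powr_add)
    then show ?thesis by (simp only: mult.assoc[symmetric] powr_mult powr_powr)
  qed
  finally have "(\<Sum>j<N. 2 powr (real j * p * (\<alpha> + 1/2 - 1/p)) *
            (\<Sum>k<2^j. L2_set (haar_coeff (2^N) (sgn_mat T) j k) {1..r} powr p)) powr (1/p)
     = 2 powr (real J * (\<alpha> + 1/2)) * (1/2)"
    using p by (simp add: powr_powr)
  moreover have "2 powr (real J * (\<alpha> + 1/2)) * (1/2) \<le> 2 powr (real J * (\<alpha> + 1/2))" by simp
  ultimately have "(\<Sum>j<N. 2 powr (real j * p * (\<alpha> + 1/2 - 1/p)) *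
            (\<Sum>k<2^j. L2_set (haar_coeff (2^N) (sgn_mat T) j k) {1..r} powr p)) powr (1/p) \<le> sqrt (2^N) * R"
    using R by linarith
  then show ?thesis
    using sgn_mat_in_prob_mats[of T] unfolding besov_body_def prob_mats_def by simp
qed

text \<open>Columns outside the flipped block have affinity one, those inside have squared affinity
  1 - 4\<delta>^2. By Bernoulli's inequality the squared product is at least 1 - 4 \<delta>^2 L =
  1/2.\<close>

lemma min_likelihood_flip:
  assumes k: "k < 2^J" "k \<notin> T"
  shows "1/4 \<le> (\<Sum>y\<in>PiE {1..2^N} (\<lambda>_. {1..r}).
     min (\<Prod>i=1..2^N. sgn_mat T (y i) i) (\<Prod>i=1..2^N. sgn_mat (insert k T) (y i) i))"
proof -
  define a where "a i = (\<Sum>l=1..r. sqrt (sgn_mat T l i * sgn_mat (insert k T) l i))" for i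
  have a2: "(a i)\<^sup>2 = (if i \<in> dyad N J k then 1 - 4 * \<delta>\<^sup>2 else 1)" if i: "i \<in> {1..2^N}" for i
  proof -
    define x where "x = sgn_pattern T i"
    define x' where "x' = sgn_pattern (insert k T) i"
    have xb: "0 \<le> 1/2 + x" "0 \<le> 1/2 - x" using sgn_pattern_bound[of T i] by (auto simp: x_def)
    have "a i = sqrt ((1/2 + x) * (1/2 + x')) + sqrt ((1/2 - x) * (1/2 - x'))"
      unfolding a_def using i by (subst sum_first_two) (auto simp: sgn_mat_def x_def x'_def)
    moreover have "x' = (if i \<in> dyad N J k then - x else x)"
      using i k by (auto simp: x_def x'_def sgn_pattern_def mem_dyad)
    moreover have "x\<^sup>2 = \<delta>\<^sup>2" unfolding x_def by (rule sgn_pattern_square)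
    moreover have "\<delta>\<^sup>2 \<le> (1/2)\<^sup>2" using \<delta>_le_half \<delta>_pos by (intro power_mono) auto
    moreover have "(1/2 + x) * (1/2 - x) = 1/4 - x\<^sup>2" "(1/2 - x) * (1/2 + x) = 1/4 - x\<^sup>2"
      by (simp_all add: power2_eq_square algebra_simps)
    ultimately show ?thesis
      using xb by (cases "i \<in> dyad N J k") (simp_all add: power_mult_distrib power2_eq_square[of "1/2"])
  qed
  define L where "L = (2::nat)^(N-J)"
  have "(\<Prod>i=1..2^N. a i)\<^sup>2 = (\<Prod>i=1..2^N. if i \<in> dyad N J k then 1 - 4 * \<delta>\<^sup>2 else 1)"
    unfolding prod_power_distrib using a2 by (intro prod.cong) auto
  also have "\<dots> = (\<Prod>i\<in>dyad N J k. 1 - 4 * \<delta>\<^sup>2)"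
    using dyad_subset_root[of J N k] JN k by (intro prod.mono_neutral_cong_right) auto
  also have "\<dots> = (1 - 4 * \<delta>\<^sup>2) ^ L" by (simp add: card_dyad L_def)
  finally have eq: "(\<Prod>i=1..2^N. a i)\<^sup>2 = (1 - 4 * \<delta>\<^sup>2) ^ L" .
  have "\<delta>\<^sup>2 \<le> (1/2)\<^sup>2" using \<delta>_le_half \<delta>_pos by (intro power_mono) auto
  then have "1 + real L * (- (4 * \<delta>\<^sup>2)) \<le> (1 + (- (4 * \<delta>\<^sup>2))) ^ L"
    by (intro Bernoulli_inequality) (simp add: power2_eq_square)
  moreover have "1 + real L * (- (4 * \<delta>\<^sup>2)) = 1/2" by (simp add: \<delta>_square L_def)
  ultimately have "1/2 \<le> (\<Prod>i=1..2^N. a i)\<^sup>2" unfolding eq by simp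
  then show ?thesis
    using min_likelihood_ge_affinity[OF sgn_mat_in_prob_mats[of T] sgn_mat_in_prob_mats[of "insert k T"]]
    unfolding a_def by linarith
qed

text \<open>The loss is localized to one block and to the first row, so that the losses of different
  blocks add up to at most the full squared loss.\<close>

definition block_loss :: "((nat \<Rightarrow> nat) \<Rightarrow> rmat) \<Rightarrow> nat \<Rightarrow> nat set \<Rightarrow> (nat \<Rightarrow> nat) \<Rightarrow> real" where
  "block_loss e k T y = (\<Sum>i\<in>dyad N J k. (sgn_mat T 1 i - e y 1 i)\<^sup>2)"

lemma sum_block_loss_le: "(\<Sum>k<2^J. block_loss e k T y) \<le> (mat_norm r (2^N) (sgn_mat T - e y))\<^sup>2"
proof -
  have "(\<Sum>k<2^J. block_loss e k T y) = (\<Sum>k<2^J. \<Sum>i\<in>{i \<in> {1..2^N}. (i - 1) div 2^(N-J) = k}. (sgn_mat T 1 i - e y 1 i)\<^sup>2)"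
    unfolding block_loss_def
  proof (intro sum.cong refl)
    fix k assume "k \<in> {..<(2::nat)^J}"
    then show "dyad N J k = {i \<in> {1..2^N}. (i - 1) div 2^(N-J) = k}"
      using dyad_subset_root[of J N k] JN by (auto simp: mem_dyad)
  qed
  also have "\<dots> = (\<Sum>i=1..2^N. (sgn_mat T 1 i - e y 1 i)\<^sup>2)"
  proof (rule sum.group)
    have "(2::nat)^N = 2^J * 2^(N-J)" using JN by (simp flip: power_add)
    then show "(\<lambda>i. (i - 1) div 2^(N-J)) ` {1..2^N} \<subseteq> {..<(2::nat)^J}"
      by (auto intro!: less_mult_imp_div_less)
  qed auto
  also have "\<dots> \<le> (\<Sum>i=1..2^N. \<Sum>l=1..r. ((sgn_mat T - e y) l i)\<^sup>2)"
  proof (rule sum_mono)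
    fix i
    have "((sgn_mat T - e y) 1 i)\<^sup>2 \<le> (\<Sum>l=1..r. ((sgn_mat T - e y) l i)\<^sup>2)"
      using r2 by (intro member_le_sum) auto
    then show "(sgn_mat T 1 i - e y 1 i)\<^sup>2 \<le> (\<Sum>l=1..r. ((sgn_mat T - e y) l i)\<^sup>2)" by simp
  qed
  finally show ?thesis unfolding mat_norm_square .
qed

text \<open>Whatever the estimate is, its first-row entries cannot be close to both 1/2 + x and 1/2
  - x: the two squared errors sum to at least 2 x^2.\<close>

lemma block_loss_flip:
  assumes k: "k < 2^J" "k \<notin> T"
  shows "1/4 \<le> block_loss e k T y + block_loss e k (insert k T) y"
proof -
  have "(\<Sum>i\<in>dyad N J k. 2 * \<delta>\<^sup>2) \<le> (\<Sum>i\<in>dyad N J k. (sgn_mat T 1 i - e y 1 i)\<^sup>2 + (sgn_mat (insert k T) 1 i - e y 1 i)\<^sup>2)"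
  proof (rule sum_mono)
    fix i assume i: "i \<in> dyad N J k"
    then have in_n: "i \<in> {1..2^N}" using dyad_subset_root[of J N k] JN k by auto
    define x where "x = sgn_pattern T i"
    define z where "z = 1/2 - e y 1 i"
    have "sgn_pattern (insert k T) i = - x"
      using i k by (simp add: x_def sgn_pattern_def mem_dyad)
    then have "sgn_mat T 1 i - e y 1 i = z + x" "sgn_mat (insert k T) 1 i - e y 1 i = z - x"
      using in_n by (simp_all add: sgn_mat_def z_def x_def)
    moreover have "(z + x)\<^sup>2 + (z - x)\<^sup>2 = 2 * z\<^sup>2 + 2 * x\<^sup>2" by (simp add: power2_eq_square algebra_simps)
    moreover have "x\<^sup>2 = \<delta>\<^sup>2" unfolding x_def by (rule sgn_pattern_square)
    ultimately show "2 * \<delta>\<^sup>2 \<le> (sgn_mat T 1 i - e y 1 i)\<^sup>2 + (sgn_mat (insert k T) 1 i - e y 1 i)\<^sup>2"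
      by simp
  qed
  moreover have "(\<Sum>i\<in>dyad N J k. 2 * \<delta>\<^sup>2) = 1/4" by (simp add: card_dyad \<delta>_square)
  ultimately show ?thesis by (simp add: block_loss_def sum.distrib)
qed

text \<open>Both likelihoods are replaced by their minimum, so that the two losses can be added at
  the same outcome; overlap 1/4 times loss 1/4 gives 1/16.\<close>

lemma expected_block_loss_flip:
  assumes k: "k < 2^J" "k \<notin> T"
  shows "1/16 \<le> prod_expect r (sgn_mat T) {1..2^N} (block_loss e k T)
     + prod_expect r (sgn_mat (insert k T)) {1..2^N} (block_loss e k (insert k T))"
proof -
  define P where "P T y = (\<Prod>i=1..2^N. sgn_mat T (y i) i)" for T and y :: "nat \<Rightarrow> nat"
  let ?Y = "PiE {1..(2::nat)^N} (\<lambda>_. {1..r})"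
  have P0: "0 \<le> P T y" if "y \<in> ?Y" for T y
    unfolding P_def
  proof (rule prod_nonneg)
    fix i :: nat assume i: "i \<in> {1..2^N}"
    show "0 \<le> sgn_mat T (y i) i"
      using sgn_mat_in_prob_mats[of T] PiE_mem[OF that i] i by (auto simp: prob_mats_def)
  qed
  have bl0: "0 \<le> block_loss e k T y" for T y by (simp add: block_loss_def sum_nonneg)
  have "(\<Sum>y\<in>?Y. min (P T y) (P (insert k T) y) * (1/4))
    \<le> (\<Sum>y\<in>?Y. P T y * block_loss e k T y + P (insert k T) y * block_loss e k (insert k T) y)"
  proof (rule sum_mono)
    fix y assume y: "y \<in> ?Y"
    let ?m = "min (P T y) (P (insert k T) y)"
    have "?m * (1/4) \<le> ?m * (block_loss e k T y + block_loss e k (insert k T) y)"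
      using block_loss_flip[OF k] P0[OF y] by (intro mult_left_mono) auto
    also have "\<dots> = ?m * block_loss e k T y + ?m * block_loss e k (insert k T) y" by (rule distrib_left)
    also have "\<dots> \<le> P T y * block_loss e k T y + P (insert k T) y * block_loss e k (insert k T) y"
      using bl0 by (intro add_mono mult_right_mono) auto
    finally show "?m * (1/4) \<le> P T y * block_loss e k T y + P (insert k T) y * block_loss e k (insert k T) y" .
  qed
  moreover have "1/4 * (1/4) \<le> (\<Sum>y\<in>?Y. min (P T y) (P (insert k T) y)) * (1/4)"
    using min_likelihood_flip[OF k] unfolding P_def by (intro mult_right_mono) auto
  ultimately have "1/4 * (1/4) \<le> (\<Sum>y\<in>?Y. P T y * block_loss e k T y)
      + (\<Sum>y\<in>?Y. P (insert k T) y * block_loss e k (insert k T) y)"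
    unfolding sum_distrib_right[symmetric] sum.distrib by linarith
  then show ?thesis unfolding prod_expect_def P_def by simp
qed

text \<open>Assouad's averaging: if every pattern had a smaller risk, so would their average, but
  pairing patterns block by block bounds the average from below.\<close>

lemma exists_bad_sign:
  "\<exists>T. 2^J / 32 \<le> prod_expect r (sgn_mat T) {1..2^N} (\<lambda>y. (mat_norm r (2^N) (sgn_mat T - e y))\<^sup>2)"
proof (rule ccontr)
  let ?A = "{..<(2::nat)^J}"
  let ?Q = "\<lambda>T. prod_expect r (sgn_mat T) {1..2^N} (\<lambda>y. (mat_norm r (2^N) (sgn_mat T - e y))\<^sup>2)"
  let ?q = "\<lambda>k T. prod_expect r (sgn_mat T) {1..2^N} (block_loss e k T)"
  assume "\<not> ?thesis"
  then have "(\<Sum>T\<in>Pow ?A. ?Q T) < (\<Sum>T\<in>Pow ?A. 2^J / 32)"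
    by (intro sum_strict_mono) (auto simp: not_le)
  \<comment> \<open>For each block the patterns form half as many pairs as there are patterns, which
    turns 1/16 per pair into 1/32 per pattern.\<close>
  also have "\<dots> = (\<Sum>k\<in>?A. \<Sum>T\<in>Pow (?A - {k}). 1/16)"
  proof -
    have "(2::real) ^ (2^J) = 2 * 2^(2^J - 1)" by (simp flip: power_Suc)
    then show ?thesis by (simp add: card_Pow)
  qed
  also have "\<dots> \<le> (\<Sum>k\<in>?A. \<Sum>T\<in>Pow (?A - {k}). ?q k T + ?q k (insert k T))"
    by (intro sum_mono expected_block_loss_flip) auto
  also have "\<dots> = (\<Sum>k\<in>?A. \<Sum>T\<in>Pow ?A. ?q k T)"
    by (intro sum.cong refl sum_Pow_split[symmetric]) auto
  also have "\<dots> = (\<Sum>T\<in>Pow ?A. \<Sum>k\<in>?A. ?q k T)" by (rule sum.swap)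
  also have "\<dots> \<le> (\<Sum>T\<in>Pow ?A. ?Q T)"
  proof (rule sum_mono)
    fix T
    have "(\<Sum>k\<in>?A. ?q k T) = prod_expect r (sgn_mat T) {1..2^N} (\<lambda>y. \<Sum>k\<in>?A. block_loss e k T y)"
      by (rule prod_expect_sum[symmetric])
    also have "\<dots> \<le> ?Q T"
      using sgn_mat_in_prob_mats[of T] by (intro prod_expect_mono sum_block_loss_le) (auto simp: prob_mats_def)
    finally show "(\<Sum>k\<in>?A. ?q k T) \<le> ?Q T" .
  qed
  finally show False by simp
qed

end

lemma minimax_risk_ge:
  assumes "J < N" "2 \<le> r" "0 < p" "2 powr (real J * (\<alpha> + 1/2)) \<le> sqrt (2^N) * R"
  shows "ennreal (2^J / 32) \<le> minimax_risk r N \<alpha> p R"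
  unfolding minimax_risk_def
proof (rule INF_greatest)
  fix e
  interpret sign_family N J r "1 / sqrt (8 * 2^(N-J))"
    using assms by unfold_locales auto
  obtain T where T: "2^J / 32 \<le> prod_expect r (sgn_mat T) {1..2^N} (\<lambda>y. (mat_norm r (2^N) (sgn_mat T - e y))\<^sup>2)"
    using exists_bad_sign by blast
  have "sgn_mat T \<in> besov_probs r N \<alpha> p R"
    using sgn_mat_in_prob_mats sgn_mat_in_besov_body[OF assms(3,4)] by (simp add: besov_probs_def)
  moreover have "ennreal (2^J / 32) \<le> risk r (2^N) (sgn_mat T) e"
    unfolding risk_eq_prod_expect[OF sgn_mat_in_prob_mats] using T by (rule ennreal_leI)
  ultimately show "ennreal (2^J / 32) \<le> (SUP s\<in>besov_probs r N \<alpha> p R. risk r (2^N) s e)"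
    by (rule SUP_upper2[where f = "\<lambda>s. risk r (2^N) s e"])
qed

section \<open>Minimax comparison\<close>

theorem theorem2:
  "\<exists>cstar::real. cstar > 0 \<and>
     (\<forall>c0 p \<alpha> :: real. c0 > cstar \<and> 0 < p \<and> p \<le> 2 \<and> \<alpha> > 1/p - 1/2 \<longrightarrow>
       (\<exists>C::real. C > 0 \<and>
         (\<forall>(r::nat) (N::nat) (R::real) mhat.
            r \<ge> 2 \<and> real (2^N) powr (-1/2) \<le> R \<and> R < real (2^N) powr \<alpha> \<and>
            is_selector c0 r N mhat \<longrightarrow>
            (SUP s \<in> besov_probs r N \<alpha> p R. risk r (2^N) s (prelim_est r (2^N) mhat))
              \<le> ennreal C * minimax_risk r N \<alpha> p R)))"
proof (rule exI[of _ "128::real"], intro conjI allI impI)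
  fix c0 p \<alpha> :: real
  assume "c0 > 128 \<and> 0 < p \<and> p \<le> 2 \<and> \<alpha> > 1/p - 1/2"
  then have c0: "128 \<le> c0" and p: "0 < p" "p \<le> 2" and \<alpha>: "\<alpha> > 1/p - 1/2" by auto
  have "1/2 \<le> 1/p" using p by (simp add: field_simps)
  then have \<alpha>0: "0 < \<alpha>" using \<alpha> by linarith
  obtain C1 C2 where C: "0 < C1" "0 < C2" and approx: "\<And>r N J R s. 0 < R \<Longrightarrow> J \<le> N \<Longrightarrow> s \<in> besov_body r N \<alpha> p R \<Longrightarrow>
      \<exists>m\<in>dyadic_partitions N. real (card m) \<le> C1 * 2^J \<and>
        (\<Sum>I\<in>m. scatter r s I) \<le> C2 * (2^N * R\<^sup>2 * 2 powr (- 2 * \<alpha> * real J))"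
    using besov_dyadic_approximation[OF p \<alpha>] by metis
  \<comment> \<open>Collects the three oracle terms in units of \<open>2^J\<close>; the 6 is the
    oracle factor 3 times the factor 2 lost when \<open>D\<close> is rounded to a power of
    two.\<close>
  define G where "G = 6 * C2 * 2 powr (2 * \<alpha>) + 2 * (c0 + 128) * C1 + 64"
  have G: "0 < G" unfolding G_def using C c0 by (intro add_pos_pos mult_pos_pos) auto
  show "\<exists>C>0. \<forall>(r::nat) (N::nat) (R::real) mhat.
            r \<ge> 2 \<and> real (2^N) powr (-1/2) \<le> R \<and> R < real (2^N) powr \<alpha> \<and>
            is_selector c0 r N mhat \<longrightarrow>
            (SUP s \<in> besov_probs r N \<alpha> p R. risk r (2^N) s (prelim_est r (2^N) mhat))
              \<le> ennreal C * minimax_risk r N \<alpha> p R"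
  proof (intro exI[of _ "32 * G"] conjI allI impI)
    show "0 < 32 * G" using G by simp
  next
    fix r N :: nat and R :: real and mhat
    assume "r \<ge> 2 \<and> real (2^N) powr (-1/2) \<le> R \<and> R < real (2^N) powr \<alpha> \<and> is_selector c0 r N mhat"
    then have r: "2 \<le> r" and R1: "(2^N) powr (-1/2) \<le> R" and R2: "R < (2^N) powr \<alpha>"
      and sel: "is_selector c0 r N mhat" by auto
    have R: "0 < R" using R1 by (rule less_le_trans[rotated]) simp
    define X where "X = 2^N * R\<^sup>2"
    \<comment> \<open>The real-valued balance point: D^(2\<alpha>+1) = X equates the approximation
      error X D^(-2\<alpha>) with the dimension \<open>D\<close>.\<close>
    define D where "D = X powr (1 / (2 * \<alpha> + 1))"
    have X0: "0 < X" using R by (simp add: X_def)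
    have sqX: "sqrt X = sqrt (2^N) * R" using R by (simp add: X_def real_sqrt_mult)
    have X1: "1 \<le> X"
    proof -
      have "R\<^sup>2 \<ge> ((2^N) powr (-1/2))\<^sup>2" using R1 by (intro power_mono) auto
      also have "((2^N) powr (-1/2))\<^sup>2 = (1 :: real) / 2^N"
        by (simp add: power2_eq_square powr_minus_divide flip: powr_add)
      finally show ?thesis by (simp add: X_def field_simps)
    qed
    have Xn: "X < (2^N) powr (2 * \<alpha> + 1)"
    proof -
      have "R\<^sup>2 < ((2^N) powr \<alpha>)\<^sup>2" using R R2 by (intro power_strict_mono) auto
      also have "((2^N) powr \<alpha>)\<^sup>2 = ((2::real)^N) powr (2 * \<alpha>)"
        by (simp add: power2_eq_square flip: powr_add)
      finally have "X < 2^N * (2^N) powr (2 * \<alpha>)" by (simp add: X_def)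
      then show ?thesis by (simp add: powr_add mult.commute)
    qed
    \<comment> \<open>The two limits on \<open>R\<close> enter here and in \<open>Dn\<close>: they
      place \<open>D\<close> between 1 and \<open>2^N\<close>, so that a level \<open>J < N\<close>
      with \<open>2^J\<close> comparable to \<open>D\<close> exists.\<close>
    have D1: "1 \<le> D" unfolding D_def using X1 \<alpha>0 by (intro ge_one_powr_ge_zero) auto
    have Dn: "D < 2^N"
    proof -
      have "D < ((2^N) powr (2 * \<alpha> + 1)) powr (1 / (2 * \<alpha> + 1))"
        unfolding D_def using Xn X0 \<alpha>0 by (intro powr_less_mono2) auto
      then show ?thesis using \<alpha>0 by (simp add: powr_powr)
    qed
    have DX: "D powr (2 * \<alpha> + 1) = X" unfolding D_def using \<alpha>0 X0 by (simp add: powr_powr)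
    obtain J where J: "2^J \<le> D" "D < 2^(J+1)"
    proof -
      define J where "J = nat \<lfloor>log 2 D\<rfloor>"
      have "real J = of_int \<lfloor>log 2 D\<rfloor>" using D1 by (simp add: J_def)
      then have "real J \<le> log 2 D" "log 2 D < real (J + 1)" by linarith+
      then have "2 powr real J \<le> D" "D < 2 powr real (J + 1)"
        using D1 powr_le_iff[of 2 D "real J"] less_powr_iff[of 2 D "real (J + 1)"] by auto
      then show ?thesis using that[of J] by (simp only: powr_realpow zero_less_numeral)
    qed
    have JN: "J < N"
    proof -
      have "(2::real)^J < 2^N" using J(1) Dn by linarith
      then show ?thesis by simp
    qed
    have low: "ennreal (2^J / 32) \<le> minimax_risk r N \<alpha> p R"
    proof (rule minimax_risk_ge[OF JN r p(1)])
      have "2 powr (real J * (\<alpha> + 1/2)) = (2^J) powr (\<alpha> + 1/2)"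
        by (simp add: powr_powr flip: powr_realpow)
      also have "\<dots> \<le> D powr (\<alpha> + 1/2)" using J(1) \<alpha>0 by (intro powr_mono2) auto
      also have "\<dots> = (D powr (2 * \<alpha> + 1)) powr (1/2)"
        by (simp add: powr_powr field_simps)
      also have "\<dots> = sqrt X" using DX X0 by (simp add: powr_half_sqrt)
      finally show "2 powr (real J * (\<alpha> + 1/2)) \<le> sqrt (2^N) * R" unfolding sqX .
    qed
    \<comment> \<open>Rounding \<open>D\<close> down to \<open>2^J\<close> costs 2^(2\<alpha>) in
      the error, and X D^(-2\<alpha>) = D < 2^(J+1) accounts for the further factor 2.\<close>
    have err: "X * 2 powr (- 2 * \<alpha> * real J) \<le> 2 * 2 powr (2 * \<alpha>) * 2^J"
    proof -
      have "2 powr (- 2 * \<alpha> * real J) = 2 powr (2 * \<alpha>) * (2^(J+1)) powr (- 2 * \<alpha>)"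
      proof -
        have "(2::real)^(J+1) = 2 powr real (J+1)" by (simp only: powr_realpow zero_less_numeral)
        then have "(2^(J+1)) powr (- 2 * \<alpha>) = 2 powr (real (J+1) * (- 2 * \<alpha>))" by (simp only: powr_powr)
        moreover have "- 2 * \<alpha> * real J = 2 * \<alpha> + real (J+1) * (- 2 * \<alpha>)" by (simp add: algebra_simps)
        ultimately show ?thesis by (simp only: powr_add)
      qed
      also have "\<dots> \<le> 2 powr (2 * \<alpha>) * D powr (- 2 * \<alpha>)"
        using J(2) D1 \<alpha>0 by (intro mult_left_mono powr_mono2') auto
      finally have "X * 2 powr (- 2 * \<alpha> * real J) \<le> X * (2 powr (2 * \<alpha>) * D powr (- 2 * \<alpha>))"
        using X0 by (intro mult_left_mono) auto
      also have "\<dots> = 2 powr (2 * \<alpha>) * (D powr (2 * \<alpha> + 1) * D powr (- 2 * \<alpha>))"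
        unfolding DX by simp
      also have "D powr (2 * \<alpha> + 1) * D powr (- 2 * \<alpha>) = D" using D1 by (simp flip: powr_add)
      also have "2 powr (2 * \<alpha>) * D \<le> 2 powr (2 * \<alpha>) * 2^(J+1)" using J(2) by (intro mult_left_mono) auto
      finally show ?thesis by (simp add: mult_ac)
    qed
    show "(SUP s \<in> besov_probs r N \<alpha> p R. risk r (2^N) s (prelim_est r (2^N) mhat))
              \<le> ennreal (32 * G) * minimax_risk r N \<alpha> p R"
    proof (rule SUP_least)
      fix s assume "s \<in> besov_probs r N \<alpha> p R"
      then have s: "s \<in> prob_mats r (2^N)" "s \<in> besov_body r N \<alpha> p R" by (auto simp: besov_probs_def)
      obtain m where m: "m \<in> dyadic_partitions N" "real (card m) \<le> C1 * 2^J"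
        "(\<Sum>I\<in>m. scatter r s I) \<le> C2 * (X * 2 powr (- 2 * \<alpha> * real J))"
        using approx[OF R less_imp_le[OF JN] s(2)] unfolding X_def by blast
      have "(\<Sum>I\<in>m. scatter r s I) \<le> C2 * (2 * 2 powr (2 * \<alpha>) * 2^J)"
        using m(3) mult_left_mono[OF err, of C2] C(2) by linarith
      moreover have "2 * (c0 + 128) * real (card m) \<le> 2 * (c0 + 128) * (C1 * 2^J)"
        using m(2) c0 by (intro mult_left_mono) auto
      moreover have "(64::real) \<le> 64 * 2^J" by simp
      moreover have "G * 2^J = 3 * (C2 * (2 * 2 powr (2 * \<alpha>) * 2^J)) + 2 * (c0 + 128) * (C1 * 2^J) + 64 * 2^J"
        by (simp add: G_def algebra_simps)
      ultimately have "3 * (\<Sum>I\<in>m. scatter r s I) + 2 * (c0 + 128) * real (card m) + 64 \<le> G * 2^J"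
        by linarith
      then have "risk r (2^N) s (prelim_est r (2^N) mhat) \<le> ennreal (G * 2^J)"
        by (rule order_trans[OF oracle_inequality[OF s(1) sel c0 m(1)] ennreal_leI])
      also have "ennreal (G * 2^J) = ennreal (32 * G) * ennreal (2^J / 32)"
        using G by (simp flip: ennreal_mult)
      also have "\<dots> \<le> ennreal (32 * G) * minimax_risk r N \<alpha> p R"
        using low by (rule mult_left_mono) simp
      finally show "risk r (2^N) s (prelim_est r (2^N) mhat) \<le> ennreal (32 * G) * minimax_risk r N \<alpha> p R" .
    qed
  qed
qed simp

end
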